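(* Let $\mu(x)=\frac{1}{\pi(1+|x|^2)^2}$ on $\mathbb R^2$ and $d\mu=\mu\,dx$. For every $f\in\mathcal D(\mathbb R^2)$ (smooth with compact support), setting $M=\int_{\mathbb R^2}e^f\,d\mu$ and $g=e^f\mu$, one has \[ \int_{\mathbb R^2}g\log\Big(\frac gM\Big)dx-\frac{4\pi}{M}\int_{\mathbb R^2}g\,(-\Delta)^{-1}g\,dx+M(1+\log\pi)\;\le\;M\Big[\frac1{16\pi}\|\nabla f\|_{L^2(\mathbb R^2)}^2+\int_{\mathbb R^2}f\,d\mu-\log M\Big]. \]
   Context: In dimension 2, $(-\Delta)^{-1}g:=G_2*g$ with $G_2(x)=-\frac1{2\pi}\log|x|$, so that $\int g(-\Delta)^{-1}g\,dx=-\frac1{2\pi}\iint g(x)g(y)\log|x-y|\,dx\,dy$. *)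

theory Defs
  imports "HOL-Analysis.Analysis"
begin

definition dirderiv :: "('a::real_normed_vector \<Rightarrow> real) \<Rightarrow> 'a \<Rightarrow> 'a \<Rightarrow> real" where
  "dirderiv f v x = frechet_derivative f (at x) v"

fun iter_dirderiv :: "('a::real_normed_vector \<Rightarrow> real) \<Rightarrow> 'a list \<Rightarrow> 'a \<Rightarrow> real" where
  "iter_dirderiv f [] = f"
| "iter_dirderiv f (v # vs) = dirderiv (iter_dirderiv f vs) v"

definition smooth :: "('a::real_normed_vector \<Rightarrow> real) \<Rightarrow> bool" where
  "smooth f \<longleftrightarrow> (\<forall>vs x. iter_dirderiv f vs differentiable (at x))"

definition test_function :: "('a::euclidean_space \<Rightarrow> real) \<Rightarrow> bool" where
  "test_function f \<longleftrightarrow> smooth f \<and> compact (closure {x. f x \<noteq> 0})"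

definition grad_norm_sq :: "('a::euclidean_space \<Rightarrow> real) \<Rightarrow> 'a \<Rightarrow> real" where
  "grad_norm_sq f x = (\<Sum>i\<in>Basis. (dirderiv f i x)^2)"

definition mu :: "real^2 \<Rightarrow> real" where
  "mu x = 1 / (pi * (1 + (norm x)^2)^2)"

text \<open>int g (-Delta)^{-1} g dx in dimension 2, with G_2(x) = -(1/(2 pi)) log|x|.\<close>
definition inv_lap_pairing :: "(real^2 \<Rightarrow> real) \<Rightarrow> real" where
  "inv_lap_pairing g = - (1 / (2 * pi)) *
     integral\<^sup>L (lborel \<Otimes>\<^sub>M lborel) (\<lambda>(x, y). g x * g y * ln (dist x y))"

end

theory Submission
  imports Defs "HOL-Real_Asymp.Real_Asymp"
begin

text \<open>
  Write \<open>L(u,v) = \<integral>\<integral> u(x) v(y) ln |x - y| dx dy\<close>. The inequality is the expansion of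
  \<open>L(u,u) \<le> 0\<close> for \<open>u = g - M \<mu> + M/(8\<pi>) \<Delta>f\<close>, which has mean zero: this is the square
  \<open>\<parallel>\<nabla>(M/(8\<pi>) f - (-\<Delta>)\<inverse>(g - M\<mu>))\<parallel>\<^sup>2 \<ge> 0\<close> in a form that needs no regularity of the potential.
  Nonpositivity of \<open>L(u,u)\<close> follows from Frullani's formula
  \<open>- 2 ln r = \<integral>\<^sub>0\<^sup>\<infinity> (exp (- t r\<^sup>2) - exp (- t)) / t dt\<close>, because Gaussian kernels are positive definite
  and the constant drops out when \<open>u\<close> has mean zero. The cross terms are explicit since
  \<open>ln |\<cdot>| * \<Delta>f = 2\<pi> f\<close> and \<open>ln |\<cdot>| * \<mu> = ln (1 + |x|\<^sup>2) / 2\<close>.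
\<close>

subsection \<open>One-dimensional integrals\<close>

text \<open>The weight is special because \<open>ln mu\<close> is affine in the logarithmic
  potential of \<open>mu\<close> itself; this is Liouville's equation, with -Delta
  \<open>ln mu\<close> equal to 8 pi times \<open>mu\<close>. The part of the entropy that comes
  from \<open>ln mu\<close> is therefore, up to a constant, the cross energy of \<open>g\<close> and
  \<open>mu\<close>. As a result the left side minus the right side of the theorem is exactly
  \<open>2 / M\<close> times L(u,u), and nothing is lost beyond its sign. The obstacle is that
  \<open>g\<close> and \<open>mu\<close> have no compact support and that their potentials grow
  logarithmically, so integrating by parts on the potentials would produce terms at infinity.
  Derivatives are only ever moved inside products with \<open>f\<close> or its derivatives, which
  are compactly supported; all else is an interchange of integrals. The kernel is singular on the
  diagonal and unbounded at infinity, and domination by \<open>mu\<close> controls both. The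
  potential of \<open>mu\<close> needs no argument about radial symmetry: \<open>mu\<close> is a
  mixture of Gaussians, so the Frullani formula that yields the sign of the energy also computes
  this potential.\<close>

lemma has_bochner_integral_FTC_nonneg:
  fixes f F :: "real \<Rightarrow> real" and a b :: ereal
  assumes "a < b"
    and "\<And>x. a < ereal x \<Longrightarrow> ereal x < b \<Longrightarrow> (F has_real_derivative f x) (at x)"
    and "\<And>x. a < ereal x \<Longrightarrow> ereal x < b \<Longrightarrow> isCont f x"
    and "\<And>x. a < ereal x \<Longrightarrow> ereal x < b \<Longrightarrow> 0 \<le> f x"
    and "((F \<circ> real_of_ereal) \<longlongrightarrow> A) (at_right a)"
    and "((F \<circ> real_of_ereal) \<longlongrightarrow> B) (at_left b)"
  shows "has_bochner_integral lborel (\<lambda>x. indicator (einterval a b) x * f x) (B - A)"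
proof -
  have "set_integrable lborel (einterval a b) f" "(LBINT x=a..b. f x) = B - A"
    using interval_integral_FTC_nonneg[of a b F f A B] assms by auto
  thus ?thesis
    using less_imp_le[OF \<open>a < b\<close>]
    by (simp add: has_bochner_integral_iff set_integrable_def interval_lebesgue_integral_def
        set_lebesgue_integral_def)
qed

lemma einterval_ereal_PInfty [simp]: "einterval (ereal a) \<infinity> = {a<..}"
  by (auto simp: einterval_def)

text \<open>For a nonnegative integrand, finite limits of the primitive at the ends already imply
  integrability, so singular or infinite ends require no separate bound.\<close>

lemma has_bochner_integral_FTC_Ioi:
  fixes f F :: "real \<Rightarrow> real"
  assumes "\<And>x. a < x \<Longrightarrow> (F has_real_derivative f x) (at x)"
    and "\<And>x. a < x \<Longrightarrow> isCont f x"
    and "\<And>x. a < x \<Longrightarrow> 0 \<le> f x"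
    and "(F \<longlongrightarrow> A) (at_right a)"
    and "(F \<longlongrightarrow> B) at_top"
  shows "has_bochner_integral lborel (\<lambda>x. indicator {a<..} x * f x) (B - A)"
  using has_bochner_integral_FTC_nonneg[of "ereal a" \<infinity> F f A B] assms
  by (simp add: ereal_tendsto_simps)

lemma has_bochner_integral_FTC_Ioo:
  fixes f F :: "real \<Rightarrow> real"
  assumes "a < b" "\<And>x. a < x \<Longrightarrow> x < b \<Longrightarrow> (F has_real_derivative f x) (at x)"
    and "\<And>x. a < x \<Longrightarrow> x < b \<Longrightarrow> isCont f x"
    and "\<And>x. a < x \<Longrightarrow> x < b \<Longrightarrow> 0 \<le> f x"
    and "(F \<longlongrightarrow> A) (at_right a)"
    and "(F \<longlongrightarrow> B) (at_left b)"
  shows "has_bochner_integral lborel (\<lambda>x. indicator {a<..<b} x * f x) (B - A)"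
  using has_bochner_integral_FTC_nonneg[of "ereal a" "ereal b" F f A B] assms
  by (simp add: ereal_tendsto_simps)

subsection \<open>Radial integrals in the plane\<close>

text \<open>A disc of radius \<open>sqrt a\<close> has area \<open>pi * a\<close>, linear in
  \<open>a\<close>. In dimension two polar coordinates in the variable s = |x|^2 thus have the
  constant density \<open>pi\<close>, and it is enough to compare both measures on the half-lines
  below \<open>a\<close>.\<close>

lemma distr_norm_sq:
  "distr lborel borel (\<lambda>x::real^2. (norm x)\<^sup>2) =
     density lborel (\<lambda>s. ennreal (pi * indicator {0<..} s))"
proof (rule measure_eqI_generator_eq_countable[where E = "range lessThan" and \<Omega> = UNIV
      and A = "range (\<lambda>n::nat. {..<real n})"])
  have eq: "emeasure (distr lborel borel (\<lambda>x::real^2. (norm x)\<^sup>2)) {..<a} = ennreal (pi * max 0 a)"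
    for a :: real
  proof -
    have "emeasure (distr lborel borel (\<lambda>x::real^2. (norm x)\<^sup>2)) {..<a}
        = emeasure lborel {x::real^2. (norm x)\<^sup>2 < a}"
      by (simp add: emeasure_distr vimage_def)
    \<comment> \<open>The maximum with 0 covers negative \<open>a\<close>, where both the set and
      the ball of radius 0 are empty.\<close>
    also have "{x::real^2. (norm x)\<^sup>2 < a} = ball 0 (sqrt (max 0 a))"
    proof -
      have "(norm x)\<^sup>2 < a \<longleftrightarrow> norm x < sqrt (max 0 a)" for x :: "real^2"
      proof -
        have "norm x < sqrt (max 0 a) \<longleftrightarrow> sqrt ((norm x)\<^sup>2) < sqrt (max 0 a)" by simp
        also have "\<dots> \<longleftrightarrow> (norm x)\<^sup>2 < max 0 a" by (rule real_sqrt_less_iff)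
        also have "\<dots> \<longleftrightarrow> (norm x)\<^sup>2 < a"
          using zero_le_power2[of "norm x"] by linarith
        finally show ?thesis by simp
      qed
      thus ?thesis by (simp only: set_eq_iff mem_Collect_eq mem_ball_0 simp_thms)
    qed
    also have "emeasure lborel \<dots> = ennreal (pi * max 0 a)"
      by (subst emeasure_ball) (simp_all add: unit_ball_vol_numeral(1)[of Num.One])
    finally show ?thesis .
  qed
  fix X :: "real set" assume "X \<in> range lessThan"
  then obtain a where X: "X = {..<a}" by auto
  have "emeasure (density lborel (\<lambda>s. ennreal (pi * indicator {0<..} s))) {..<a}
      = (\<integral>\<^sup>+s. ennreal pi * indicator {0<..<a} s \<partial>lborel)"
    by (subst emeasure_density) (auto intro!: nn_integral_cong simp: indicator_def)
  also have "\<dots> = ennreal pi * ennreal (max 0 a)"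
    by (subst nn_integral_cmult_indicator) (auto simp: max_def)
  also have "\<dots> = ennreal (pi * max 0 a)" by (simp add: ennreal_mult)
  finally show "emeasure (distr lborel borel (\<lambda>x::real^2. (norm x)\<^sup>2)) X
      = emeasure (density lborel (\<lambda>s. ennreal (pi * indicator {0<..} s))) X"
    unfolding X eq by simp
next
  fix X assume "X \<in> range (\<lambda>n::nat. {..<real n})"
  then obtain n :: nat where X: "X = {..<real n}" by auto
  have "{x::real^2. (norm x)\<^sup>2 < real n} \<subseteq> ball 0 (sqrt (real n))"
    by (auto intro: real_less_rsqrt)
  hence "emeasure lborel {x::real^2. (norm x)\<^sup>2 < real n} \<le> emeasure lborel (ball (0::real^2) (sqrt (real n)))"
    by (intro emeasure_mono) auto
  also have "\<dots> < \<infinity>" by (rule emeasure_lborel_ball_finite)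
  finally show "emeasure (distr lborel borel (\<lambda>x::real^2. (norm x)\<^sup>2)) X \<noteq> \<infinity>"
    by (simp add: X emeasure_distr vimage_def)
next
  have "\<exists>n::nat. x < real n" for x :: real by (rule reals_Archimedean2)
  thus "\<Union> (range (\<lambda>n::nat. {..<real n})) = UNIV" by auto
next
  show "Int_stable (range (lessThan :: real \<Rightarrow> real set))"
  proof (rule Int_stableI)
    fix X Y :: "real set" assume "X \<in> range lessThan" "Y \<in> range lessThan"
    then obtain a b where "X = {..<a}" "Y = {..<b}" by auto
    hence "X \<inter> Y = {..<min a b}" by auto
    thus "X \<inter> Y \<in> range lessThan" by simp
  qed
  have "sets (borel::real measure) = sigma_sets UNIV (range lessThan)"
    by (subst borel_Iio) (rule sets_measure_of, simp)
  thus "sets (distr lborel borel (\<lambda>x::real^2. (norm x)\<^sup>2)) = sigma_sets UNIV (range lessThan)"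
    "sets (density lborel (\<lambda>s::real. ennreal (pi * indicator {0<..} s))) = sigma_sets UNIV (range lessThan)"
    by simp_all
qed auto

lemma has_bochner_integral_radial:
  fixes \<phi> :: "real \<Rightarrow> real"
  assumes [measurable]: "\<phi> \<in> borel_measurable borel"
    and "has_bochner_integral lborel (\<lambda>s. indicator {0<..} s * \<phi> s) I"
  shows "has_bochner_integral lborel (\<lambda>x::real^2. \<phi> ((norm x)\<^sup>2)) (pi * I)"
proof -
  have "has_bochner_integral lborel (\<lambda>s. (pi * indicator {0<..} s) *\<^sub>R \<phi> s) (pi * I)"
    using has_bochner_integral_mult_right[OF assms(2), of pi] by (simp add: mult.assoc)
  hence "has_bochner_integral (density lborel (\<lambda>s. ennreal (pi * indicator {0<..} s))) \<phi> (pi * I)"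
    by (subst has_bochner_integral_density) auto
  thus ?thesis
    unfolding distr_norm_sq[symmetric]
    by (simp add: has_bochner_integral_iff integrable_distr_eq integral_distr)
qed

lemma has_bochner_integral_exp_Ioi:
  assumes "(c::real) > 0"
  shows "has_bochner_integral lborel (\<lambda>s. indicator {0<..} s * exp (- (c * s))) (1 / c)"
proof -
  have "has_bochner_integral lborel (\<lambda>s. indicator {0<..} s * exp (- (c * s))) (0 - (- 1 / c))"
  proof (rule has_bochner_integral_FTC_Ioi[where F = "\<lambda>s. - exp (- (c * s)) / c"])
    show "((\<lambda>s. - exp (- (c * s)) / c) \<longlongrightarrow> - 1 / c) (at_right 0)"
      by (rule tendsto_eq_intros refl | use assms in simp)+
    have "filterlim (\<lambda>s. c * s) at_top at_top"
      by (rule filterlim_tendsto_pos_mult_at_top[OF tendsto_const assms filterlim_ident])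
    hence "((\<lambda>s. exp (- (c * s))) \<longlongrightarrow> 0) at_top"
      by (intro filterlim_compose[OF exp_at_bot]) (simp add: filterlim_uminus_at_top)
    thus "((\<lambda>s. - exp (- (c * s)) / c) \<longlongrightarrow> 0) at_top"
      using tendsto_divide[OF tendsto_minus tendsto_const[of c]] assms by fastforce
  qed (use assms in \<open>auto intro!: derivative_eq_intros\<close>)
  thus ?thesis by simp
qed

lemma has_bochner_integral_Ioi_inverse_sq:
  "has_bochner_integral lborel (\<lambda>s::real. indicator {0<..} s * (1 / (1 + s)\<^sup>2)) 1"
proof -
  have "has_bochner_integral lborel (\<lambda>s::real. indicator {0<..} s * (1 / (1 + s)\<^sup>2)) (0 - (-1))"
  proof (rule has_bochner_integral_FTC_Ioi[where F = "\<lambda>s. - 1 / (1 + s)"])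
    show "((\<lambda>s::real. - 1 / (1 + s)) \<longlongrightarrow> - 1) (at_right 0)"
      by (rule tendsto_eq_intros refl | simp)+
    show "((\<lambda>s::real. - 1 / (1 + s)) \<longlongrightarrow> 0) at_top" by real_asymp
    show "isCont (\<lambda>s::real. 1 / (1 + s)\<^sup>2) s" if "s > 0" for s
      using that by (intro continuous_intros) auto
    show "((\<lambda>s. - 1 / (1 + s)) has_real_derivative 1 / (1 + s)\<^sup>2) (at s)" if "s > 0" for s
      using that by (auto intro!: derivative_eq_intros simp: power2_eq_square)
  qed auto
  thus ?thesis by simp
qed

lemma has_bochner_integral_Ioi_ln_inverse_sq:
  "has_bochner_integral lborel (\<lambda>s::real. indicator {0<..} s * (ln (1 + s) / (1 + s)\<^sup>2)) 1"
proof -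
  have "has_bochner_integral lborel (\<lambda>s::real. indicator {0<..} s * (ln (1 + s) / (1 + s)\<^sup>2)) (0 - (-1))"
  proof (rule has_bochner_integral_FTC_Ioi[where F = "\<lambda>s. - (ln (1 + s) + 1) / (1 + s)"])
    show "((\<lambda>s::real. - (ln (1 + s) + 1) / (1 + s)) \<longlongrightarrow> - 1) (at_right 0)"
      by (rule tendsto_eq_intros refl | simp)+
    show "((\<lambda>s::real. - (ln (1 + s) + 1) / (1 + s)) \<longlongrightarrow> 0) at_top" by real_asymp
    show "isCont (\<lambda>s::real. ln (1 + s) / (1 + s)\<^sup>2) s" if "s > 0" for s
      using that by (intro continuous_intros) auto
    show "((\<lambda>s. - (ln (1 + s) + 1) / (1 + s)) has_real_derivative ln (1 + s) / (1 + s)\<^sup>2) (at s)"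
      if "s > 0" for s
      using that by (auto intro!: derivative_eq_intros simp: power2_eq_square divide_simps)
  qed auto
  thus ?thesis by simp
qed

text \<open>The value is 0 because s -> 1/s preserves ds/(1+s)^2 and changes the sign of
  \<open>ln s\<close>. The proof uses the explicit primitive instead, and it cuts at 1 because the
  fundamental theorem is applied to integrands of one sign.\<close>

lemma has_bochner_integral_Ioi_ln_zero:
  "has_bochner_integral lborel (\<lambda>s::real. indicator {0<..} s * (ln s / (1 + s)\<^sup>2)) 0"
proof -
  let ?F = "\<lambda>s::real. s * ln s / (1 + s) - ln (1 + s)"
  have D: "(?F has_real_derivative ln s / (1 + s)\<^sup>2) (at s)" if "s > 0" for s
  proof -
    have "(?F has_real_derivative
        ((1 * ln s + s * (1 / s)) * (1 + s) - s * ln s * 1) / ((1 + s) * (1 + s)) - 1 / (1 + s)) (at s)"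
      using that by (intro derivative_eq_intros refl) auto
    also have "((1 * ln s + s * (1 / s)) * (1 + s) - s * ln s * 1) / ((1 + s) * (1 + s)) - 1 / (1 + s)
        = ((ln s + 1) * (1 + s) - s * ln s - (1 + s)) / ((1 + s) * (1 + s))"
      using that by (simp add: diff_divide_distrib)
    also have "\<dots> = ln s / (1 + s)\<^sup>2"
      by (simp add: algebra_simps power2_eq_square)
    finally show ?thesis .
  qed
  \<comment> \<open>The two pieces contribute \<open>ln 2\<close> with opposite signs. The point s =
    1 lies in neither of them, which is harmless because \<open>ln 1 = 0\<close>.\<close>
  have 1: "has_bochner_integral lborel (\<lambda>s::real. indicator {0<..<1} s * (- ln s / (1 + s)\<^sup>2)) (ln 2 - 0)"
  proof (rule has_bochner_integral_FTC_Ioo[where F = "\<lambda>s. - ?F s"])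
    show "((\<lambda>s. - ?F s) \<longlongrightarrow> 0) (at_right 0)" by real_asymp
    show "((\<lambda>s. - ?F s) \<longlongrightarrow> ln 2) (at_left 1)"
      by (rule tendsto_eq_intros refl | simp)+
    show "((\<lambda>s. - ?F s) has_real_derivative - ln s / (1 + s)\<^sup>2) (at s)" if "s > 0" for s
      using DERIV_minus[OF D[OF that]] by simp
  qed (auto intro!: continuous_intros divide_nonpos_pos)
  have 2: "has_bochner_integral lborel (\<lambda>s::real. indicator {1<..} s * (ln s / (1 + s)\<^sup>2)) (0 - (- ln 2))"
  proof (rule has_bochner_integral_FTC_Ioi[where F = ?F])
    show "(?F \<longlongrightarrow> 0) at_top" by real_asymp
    show "(?F \<longlongrightarrow> - ln 2) (at_right 1)"
      by (rule tendsto_eq_intros refl | simp)+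
  qed (auto intro!: D continuous_intros)
  have "has_bochner_integral lborel (\<lambda>s::real. indicator {1<..} s * (ln s / (1 + s)\<^sup>2)
      - indicator {0<..<1} s * (- ln s / (1 + s)\<^sup>2)) ((0 - (- ln 2)) - (ln 2 - 0))"
    by (rule has_bochner_integral_diff[OF 2 1])
  also have "(\<lambda>s::real. indicator {1<..} s * (ln s / (1 + s)\<^sup>2)
      - indicator {0<..<1} s * (- ln s / (1 + s)\<^sup>2)) = (\<lambda>s. indicator {0<..} s * (ln s / (1 + s)\<^sup>2))"
  proof
    fix s :: real
    show "indicator {1<..} s * (ln s / (1 + s)\<^sup>2) - indicator {0<..<1} s * (- ln s / (1 + s)\<^sup>2)
        = indicator {0<..} s * (ln s / (1 + s)\<^sup>2)"
      by (cases "s = 1") (auto simp: indicator_def)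
  qed
  finally show ?thesis by simp
qed

lemma has_bochner_integral_inverse_sqrt:
  "has_bochner_integral lborel (\<lambda>s::real. indicator {0<..<1} s * (1 / sqrt s)) 2"
proof -
  have "has_bochner_integral lborel (\<lambda>s::real. indicator {0<..<1} s * (1 / sqrt s)) (2 - 0)"
  proof (rule has_bochner_integral_FTC_Ioo[where F = "\<lambda>s. 2 * sqrt s"])
    show "((\<lambda>s. 2 * sqrt s) \<longlongrightarrow> 0) (at_right 0)" by (rule tendsto_eq_intros refl | simp)+
    show "((\<lambda>s. 2 * sqrt s) \<longlongrightarrow> 2) (at_left 1)" by (rule tendsto_eq_intros refl | simp)+
  qed (auto intro!: derivative_eq_intros continuous_intros simp: field_simps)
  thus ?thesis by simp
qed

section \<open>Moments of the weight \<open>mu\<close>\<close>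

definition mu_pot :: "real^2 \<Rightarrow> real" where
  "mu_pot x = ln (1 + (norm x)\<^sup>2) / 2"

lemma mu_measurable [measurable]: "mu \<in> borel_measurable borel"
  unfolding mu_def by measurable

lemma mu_pot_measurable [measurable]: "mu_pot \<in> borel_measurable borel"
  unfolding mu_pot_def by measurable

lemma one_plus_norm_sq_pos: "0 < 1 + (norm x)\<^sup>2"
  by (smt (verit) zero_le_power2)

lemma mu_pos: "mu x > 0"
  using one_plus_norm_sq_pos[of x] by (simp add: mu_def)

lemma mu_pot_nonneg: "mu_pot x \<ge> 0"
  by (simp add: mu_pot_def)

text \<open>The only place where the shape of \<open>mu\<close> meets the entropy: since
  \<open>mu_pot\<close> will turn out to be the logarithmic potential of \<open>mu\<close>, the
  factor 4 here matches the cross term of \<open>g\<close> and \<open>mu\<close> in the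
  energy.\<close>

lemma ln_mu: "ln (mu x) = - ln pi - 4 * mu_pot x"
  using one_plus_norm_sq_pos[of x]
  by (simp add: mu_def mu_pot_def ln_div ln_mult ln_realpow)

lemma has_bochner_integral_mu: "has_bochner_integral lborel mu 1"
proof -
  have "has_bochner_integral lborel (\<lambda>x::real^2. 1 / (1 + (norm x)\<^sup>2)\<^sup>2) (pi * 1)"
    using has_bochner_integral_radial[OF _ has_bochner_integral_Ioi_inverse_sq] by simp
  from has_bochner_integral_mult_right[OF this, of "1 / pi"] show ?thesis
    by (simp add: mu_def[abs_def])
qed

lemma has_bochner_integral_mu_mu_pot: "has_bochner_integral lborel (\<lambda>x. mu x * mu_pot x) (1 / 2)"
proof -
  have "has_bochner_integral lborel (\<lambda>x::real^2. ln (1 + (norm x)\<^sup>2) / (1 + (norm x)\<^sup>2)\<^sup>2) (pi * 1)"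
    using has_bochner_integral_radial[OF _ has_bochner_integral_Ioi_ln_inverse_sq] by simp
  from has_bochner_integral_mult_right[OF this, of "1 / (2 * pi)"] show ?thesis
    by (simp add: mu_def[abs_def] mu_pot_def mult_ac)
qed

text \<open>The logarithmic potential of \<open>mu\<close> vanishes at the origin. This fixes the
  additive constant when the potential at a general point is computed as a difference.\<close>

lemma has_bochner_integral_mu_ln_norm: "has_bochner_integral lborel (\<lambda>x. mu x * ln (norm x)) 0"
proof -
  have "has_bochner_integral lborel (\<lambda>x::real^2. ln ((norm x)\<^sup>2) / (1 + (norm x)\<^sup>2)\<^sup>2) (pi * 0)"
    using has_bochner_integral_radial[OF _ has_bochner_integral_Ioi_ln_zero] by simp
  from has_bochner_integral_mult_right[OF this, of "1 / (2 * pi)"]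
  have "has_bochner_integral lborel
      (\<lambda>x::real^2. 1 / (2 * pi) * (ln ((norm x)\<^sup>2) / (1 + (norm x)\<^sup>2)\<^sup>2)) 0"
    by simp
  also have "(\<lambda>x::real^2. 1 / (2 * pi) * (ln ((norm x)\<^sup>2) / (1 + (norm x)\<^sup>2)\<^sup>2)) = (\<lambda>x. mu x * ln (norm x))"
  proof
    fix x :: "real^2"
    \<comment> \<open>At the origin both sides are 0 by the convention
      \<open>ln 0 = 0\<close>.\<close>
    have "ln ((norm x)\<^sup>2) = 2 * ln (norm x)" by (cases "x = 0") (auto simp: ln_realpow)
    thus "1 / (2 * pi) * (ln ((norm x)\<^sup>2) / (1 + (norm x)\<^sup>2)\<^sup>2) = mu x * ln (norm x)"
      by (simp add: mu_def)
  qed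
  finally show ?thesis .
qed

lemma has_bochner_integral_inverse_norm_ball:
  "has_bochner_integral lborel (\<lambda>z::real^2. indicator (ball 0 1) z / norm z) (2 * pi)"
proof -
  have "has_bochner_integral lborel (\<lambda>s::real. indicator {0<..} s * (indicator {0<..<1} s * (1 / sqrt s))) 2"
    using has_bochner_integral_inverse_sqrt
    by (rule has_bochner_integral_cong[THEN iffD1, rotated -1]) (auto simp: indicator_def)
  hence "has_bochner_integral lborel (\<lambda>z::real^2. indicator {0<..<1} ((norm z)\<^sup>2) * (1 / sqrt ((norm z)\<^sup>2))) (pi * 2)"
    by (intro has_bochner_integral_radial) auto
  also have "(\<lambda>z::real^2. indicator {0<..<1} ((norm z)\<^sup>2) * (1 / sqrt ((norm z)\<^sup>2)))
      = (\<lambda>z. indicator (ball 0 1) z / norm z)"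
    by (auto simp: indicator_def fun_eq_iff abs_square_less_1)
  finally show ?thesis by (simp add: mult.commute)
qed

section \<open>Translation invariance and Gaussian integrals in the plane\<close>

lemma integrable_translate:
  fixes f :: "'a::euclidean_space \<Rightarrow> real"
  shows "integrable lborel (\<lambda>x. f (a + x)) \<longleftrightarrow> integrable lborel f"
proof -
  have *: "integrable lborel (\<lambda>x. h (a + x))" if "integrable lborel h" for h :: "'a \<Rightarrow> real" and a
  proof -
    have "integrable (distr lborel borel ((+) a)) h" using that by (simp add: lborel_distr_plus)
    thus ?thesis using that by (subst (asm) integrable_distr_eq) auto
  qed
  show ?thesis using *[of f a] *[of "\<lambda>x. f (a + x)" "-a"] by auto
qed

lemma integral_translate:
  fixes f :: "'a::euclidean_space \<Rightarrow> real"
  shows "(\<integral>x. f (a + x) \<partial>lborel) = (\<integral>x. f x \<partial>lborel)"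
proof (cases "integrable lborel f")
  case True
  have "(\<integral>x. f x \<partial>lborel) = (\<integral>x. f x \<partial>distr lborel borel ((+) a))" by (simp add: lborel_distr_plus)
  also have "\<dots> = (\<integral>x. f (a + x) \<partial>lborel)" using True by (subst integral_distr) auto
  finally show ?thesis ..
next
  case False
  thus ?thesis by (simp add: not_integrable_integral_eq integrable_translate)
qed

lemma has_bochner_integral_translate:
  fixes f :: "'a::euclidean_space \<Rightarrow> real"
  shows "has_bochner_integral lborel (\<lambda>x. f (a + x)) I \<longleftrightarrow> has_bochner_integral lborel f I"
  by (simp add: has_bochner_integral_iff integrable_translate integral_translate)

lemma has_bochner_integral_gaussian:
  assumes "c > 0"
  shows "has_bochner_integral lborel (\<lambda>x::real^2. exp (- (c * (norm x)\<^sup>2))) (pi / c)"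
  using has_bochner_integral_radial[OF _ has_bochner_integral_exp_Ioi[OF assms]] by simp

text \<open>Completing the square. It serves twice: to write a Gaussian as a convolution square, and
  to average a Gaussian against \<open>mu\<close> once \<open>mu\<close> is written as a mixture of
  Gaussians.\<close>

lemma has_bochner_integral_gaussian_product:
  fixes x :: "real^2"
  assumes "s > 0" "t \<ge> 0"
  shows "has_bochner_integral lborel (\<lambda>y. exp (- (s * (norm y)\<^sup>2)) * exp (- (t * (norm (x - y))\<^sup>2)))
           (pi / (s + t) * exp (- (s * t / (s + t) * (norm x)\<^sup>2)))"
proof -
  have st: "s + t > 0" using assms by simp
  \<comment> \<open>The minimiser in \<open>y\<close> of the exponent s|y|^2 + t|x - y|^2, that is,
    the centre of the product Gaussian.\<close>
  define a where "a = (t / (s + t)) *\<^sub>R x"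
  have eq: "s * (norm (a + y))\<^sup>2 + t * (norm (x - (a + y)))\<^sup>2
      = (s + t) * (norm y)\<^sup>2 + s * t / (s + t) * (norm x)\<^sup>2" for y
  proof -
    define k where "k = t / (s + t)"
    have k: "(s + t) * k = t" using st by (simp add: k_def)
    have "s * (norm (a + y))\<^sup>2 + t * (norm (x - (a + y)))\<^sup>2
        = (s * k\<^sup>2 + t * (1 - k)\<^sup>2) * (x \<bullet> x) + 2 * (s * k - t * (1 - k)) * (x \<bullet> y) + (s + t) * (y \<bullet> y)"
      unfolding a_def k_def[symmetric] power2_norm_eq_inner
      by (simp add: inner_simps inner_commute power2_eq_square algebra_simps)
    also have "s * k - t * (1 - k) = 0" using k by (simp add: algebra_simps)
    also have "s * k\<^sup>2 + t * (1 - k)\<^sup>2 = ((s + t) * k) * k - 2 * t * k + t"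
      by (simp add: power2_eq_square algebra_simps)
    also have "\<dots> = s * t / (s + t)"
    proof -
      have "1 - k = s / (s + t)" using st by (simp add: k_def field_simps)
      hence "t * (1 - k) = s * t / (s + t)" by simp
      thus ?thesis unfolding k by (simp add: algebra_simps)
    qed
    finally show ?thesis by (simp add: power2_norm_eq_inner)
  qed
  have "has_bochner_integral lborel
      (\<lambda>y::real^2. exp (- (s * t / (s + t) * (norm x)\<^sup>2)) * exp (- ((s + t) * (norm y)\<^sup>2)))
      (exp (- (s * t / (s + t) * (norm x)\<^sup>2)) * (pi / (s + t)))"
    by (intro has_bochner_integral_mult_right has_bochner_integral_gaussian st)
  moreover have "exp (- (s * t / (s + t) * (norm x)\<^sup>2)) * exp (- ((s + t) * (norm y)\<^sup>2))
      = exp (- (s * (norm (a + y))\<^sup>2)) * exp (- (t * (norm (x - (a + y)))\<^sup>2))" for y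
    unfolding exp_add[symmetric] using eq[of y] by (intro arg_cong[where f = exp]) linarith
  ultimately have "has_bochner_integral lborel
      (\<lambda>y. exp (- (s * (norm (a + y))\<^sup>2)) * exp (- (t * (norm (x - (a + y)))\<^sup>2)))
      (pi / (s + t) * exp (- (s * t / (s + t) * (norm x)\<^sup>2)))"
    by (simp add: mult.commute)
  thus ?thesis by (subst (asm) has_bochner_integral_translate)
qed

subsection \<open>Functions dominated by the weight\<close>

text \<open>A class that contains \<open>mu\<close>, \<open>g\<close> and all test functions, is
  closed under linear combinations, and on which the logarithmic double integral converges
  absolutely. Compact support would be too narrow, since \<open>mu\<close> and \<open>g\<close> are
  everywhere positive.\<close>

definition mu_bounded :: "(real^2 \<Rightarrow> real) \<Rightarrow> bool" where
  "mu_bounded u \<longleftrightarrow> u \<in> borel_measurable borel \<and> (\<exists>C. \<forall>x. \<bar>u x\<bar> \<le> C * mu x)"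

lemma mu_boundedI:
  assumes "u \<in> borel_measurable borel" "\<And>x. \<bar>u x\<bar> \<le> C * mu x"
  shows "mu_bounded u"
  using assms unfolding mu_bounded_def by blast

lemma mu_bounded_measurable: "mu_bounded u \<Longrightarrow> u \<in> borel_measurable borel"
  by (simp add: mu_bounded_def)

lemma mu_bounded_mu: "mu_bounded mu"
  by (rule mu_boundedI[where C = 1]) (auto simp: less_imp_le[OF mu_pos])

lemma mu_bounded_add:
  assumes "mu_bounded u" "mu_bounded v"
  shows "mu_bounded (\<lambda>x. u x + v x)"
proof -
  obtain C D where "\<And>x. \<bar>u x\<bar> \<le> C * mu x" "\<And>x. \<bar>v x\<bar> \<le> D * mu x"
    using assms unfolding mu_bounded_def by blast
  hence "\<bar>u x + v x\<bar> \<le> (C + D) * mu x" for x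
    unfolding distrib_right by (rule order_trans[OF abs_triangle_ineq add_mono])
  thus ?thesis using assms[THEN mu_bounded_measurable] by (intro mu_boundedI) auto
qed

lemma mu_bounded_cmult:
  assumes "mu_bounded u"
  shows "mu_bounded (\<lambda>x. c * u x)"
proof -
  obtain C where "\<And>x. \<bar>u x\<bar> \<le> C * mu x"
    using assms unfolding mu_bounded_def by blast
  hence "\<bar>c * u x\<bar> \<le> (\<bar>c\<bar> * C) * mu x" for x
    unfolding abs_mult mult.assoc by (intro mult_left_mono) auto
  thus ?thesis using assms[THEN mu_bounded_measurable] by (intro mu_boundedI) auto
qed

lemma mu_bounded_integrable_mult:
  assumes "mu_bounded u" and [measurable]: "h \<in> borel_measurable borel"
    and "integrable lborel (\<lambda>x. mu x * h x)"
  shows "integrable lborel (\<lambda>x. u x * h x)"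
proof -
  obtain C where C: "\<And>x. \<bar>u x\<bar> \<le> C * mu x"
    using assms unfolding mu_bounded_def by blast
  have [measurable]: "u \<in> borel_measurable borel" by (rule mu_bounded_measurable[OF assms(1)])
  show ?thesis
  proof (rule Bochner_Integration.integrable_bound)
    show "integrable lborel (\<lambda>x. C * (mu x * h x))" using assms(3) by simp
    have "\<bar>u x\<bar> * \<bar>h x\<bar> \<le> \<bar>C * mu x\<bar> * \<bar>h x\<bar>" for x
      using C[of x] by (intro mult_right_mono) auto
    thus "AE x in lborel. norm (u x * h x) \<le> norm (C * (mu x * h x))"
      by (simp add: abs_mult mult_ac)
  qed simp
qed

lemma mu_bounded_integrable: "mu_bounded u \<Longrightarrow> integrable lborel u"
  using mu_bounded_integrable_mult[of u "\<lambda>_. 1"] has_bochner_integral_mu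
  by (simp add: has_bochner_integral_iff)

lemma mu_bounded_integrable_mu_pot: "mu_bounded u \<Longrightarrow> integrable lborel (\<lambda>x. u x * mu_pot x)"
  using mu_bounded_integrable_mult[of u mu_pot] has_bochner_integral_mu_mu_pot
  by (simp add: has_bochner_integral_iff)

text \<open>Since 1 + |x - y|^2 is at most 2 (1 + |x|^2)(1 + |y|^2), the growth of the kernel at
  infinity splits into functions of one variable, each integrable against \<open>mu\<close>.\<close>

lemma ln_one_plus_dist_sq_le: "ln (1 + (dist x y)\<^sup>2) / 2 \<le> mu_pot x + mu_pot y + ln 2 / 2"
proof -
  have "(dist x y)\<^sup>2 \<le> (norm x + norm y)\<^sup>2"
    by (intro power_mono norm_triangle_ineq4[of x y, folded dist_norm]) auto
  also have "\<dots> \<le> 2 * (norm x)\<^sup>2 + 2 * (norm y)\<^sup>2"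
    using sum_squares_ge_zero[of "norm x - norm y" 0] by (simp add: power2_eq_square algebra_simps)
  finally have "1 + (dist x y)\<^sup>2 \<le> 1 + (2 * (norm x)\<^sup>2 + 2 * (norm y)\<^sup>2)" by simp
  also have "1 + (2 * (norm x)\<^sup>2 + 2 * (norm y)\<^sup>2) \<le> 2 * ((1 + (norm x)\<^sup>2) * (1 + (norm y)\<^sup>2))"
    by (simp add: algebra_simps)
  finally have "1 + (dist x y)\<^sup>2 \<le> 2 * ((1 + (norm x)\<^sup>2) * (1 + (norm y)\<^sup>2))" .
  hence "ln (1 + (dist x y)\<^sup>2) \<le> ln (2 * ((1 + (norm x)\<^sup>2) * (1 + (norm y)\<^sup>2)))"
    by (smt (verit) ln_mono zero_le_power2)
  also have "\<dots> = ln 2 + (ln (1 + (norm x)\<^sup>2) + ln (1 + (norm y)\<^sup>2))"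
    using one_plus_norm_sq_pos[of x] one_plus_norm_sq_pos[of y]
    by (simp add: ln_mult del: add_pos_nonneg)
  finally show ?thesis by (simp add: mu_pot_def)
qed

text \<open>Within distance 1 the singularity is bounded by ln(1/r) <= 1/r - 1, and 1/r is locally
  integrable in the plane; beyond distance 1 only the growth counts. The difference is written as
  \<open>- x + y\<close> so that translation invariance in \<open>y\<close> applies
  directly.\<close>

lemma abs_ln_dist_le:
  "\<bar>ln (dist x y)\<bar> \<le> mu_pot x + mu_pot y + ln 2 / 2 + indicator (ball 0 1) (- x + y) / norm (- x + y)"
proof -
  have d: "dist x y = norm (- x + y)" by (simp add: dist_norm norm_minus_commute)
  consider "x = y" | "x \<noteq> y" "dist x y < 1" | "dist x y \<ge> 1" by force
  thus ?thesis
  proof cases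
    case 1
    \<comment> \<open>On the diagonal \<open>ln 0 = 0\<close> and division by zero gives 0, so both
      singular terms vanish.\<close>
    thus ?thesis using mu_pot_nonneg[of y] by simp
  next
    case 2
    have "\<bar>ln (dist x y)\<bar> = ln (1 / dist x y)" using 2 by (simp add: ln_div)
    also have "\<dots> \<le> 1 / dist x y - 1" using 2 by (intro ln_le_minus_one) auto
    also have "1 / dist x y = indicator (ball 0 1) (- x + y) / norm (- x + y)"
      using 2 unfolding d by (simp add: indicator_def)
    finally show ?thesis
      using mu_pot_nonneg[of x] mu_pot_nonneg[of y] ln_ge_zero[of 2] by linarith
  next
    case 3
    have "\<bar>ln (dist x y)\<bar> = ln ((dist x y)\<^sup>2) / 2" using 3 by (subst ln_realpow) auto
    also have "\<dots> \<le> ln (1 + (dist x y)\<^sup>2) / 2"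
      using 3 by (intro divide_right_mono ln_mono) auto
    also have "\<dots> \<le> mu_pot x + mu_pot y + ln 2 / 2" by (rule ln_one_plus_dist_sq_le)
    finally have "\<bar>ln (dist x y)\<bar> \<le> mu_pot x + mu_pot y + ln 2 / 2" .
    moreover have "0 \<le> indicat_real (ball 0 1) (- x + y) / norm (- x + y)" by simp
    ultimately show ?thesis by linarith
  qed
qed

lemma mu_le: "mu x \<le> 1 / pi"
proof -
  have "1 \<le> (1 + (norm x)\<^sup>2)\<^sup>2" by (intro one_le_power) simp
  thus ?thesis by (simp add: mu_def divide_le_cancel frac_le)
qed

text \<open>The bound grows only like \<open>mu_pot x\<close>, which is again integrable against
  \<open>mu\<close>, so it also settles the outer integral in Fubini. The constant 5/2 is 1/2, the
  integral of \<open>mu * mu_pot\<close>, plus 2, from \<open>mu <= 1 / pi\<close> times the mass 2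
  pi of 1/|z| on the unit ball.\<close>

lemma integrable_mu_ln_dist: "integrable lborel (\<lambda>y. mu y * ln (dist x y))" (is ?A)
  and integral_mu_abs_ln_dist_le:
    "(\<integral>y. mu y * \<bar>ln (dist x y)\<bar> \<partial>lborel) \<le> mu_pot x + (5 / 2 + ln 2 / 2)" (is ?B)
proof -
  define m where "m y = (mu_pot x + ln 2 / 2) * mu y + mu y * mu_pot y
    + 1 / pi * (indicator (ball 0 1) (- x + y) / norm (- x + y))" for y
  have m: "has_bochner_integral lborel m ((mu_pot x + ln 2 / 2) * 1 + 1 / 2 + 1 / pi * (2 * pi))"
    unfolding m_def
    by (intro has_bochner_integral_add has_bochner_integral_mult_right has_bochner_integral_mu
        has_bochner_integral_mu_mu_pot has_bochner_integral_translate[THEN iffD2]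
        has_bochner_integral_inverse_norm_ball)
  have le: "mu y * \<bar>ln (dist x y)\<bar> \<le> m y" for y
  proof -
    have "mu y * \<bar>ln (dist x y)\<bar>
        \<le> mu y * (mu_pot x + mu_pot y + ln 2 / 2 + indicator (ball 0 1) (- x + y) / norm (- x + y))"
      by (intro mult_left_mono abs_ln_dist_le less_imp_le[OF mu_pos])
    also have "\<dots> \<le> mu y * (mu_pot x + mu_pot y + ln 2 / 2) + 1 / pi * (indicator (ball 0 1) (- x + y) / norm (- x + y))"
      unfolding distrib_left[of _ "mu_pot x + mu_pot y + ln 2 / 2"]
      by (intro add_mono order_refl mult_right_mono mu_le) (simp_all add: indicator_def)
    also have "\<dots> = m y" by (simp add: m_def algebra_simps)
    finally show ?thesis .
  qed
  show A: ?A
  proof (rule Bochner_Integration.integrable_bound)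
    show "integrable lborel m" using m by (simp add: has_bochner_integral_iff)
    show "AE y in lborel. norm (mu y * ln (dist x y)) \<le> norm (m y)"
      using order_trans[OF le abs_ge_self] by (simp add: abs_mult abs_of_pos[OF mu_pos])
  qed simp
  have "integrable lborel (\<lambda>y. \<bar>mu y * ln (dist x y)\<bar>)" using A by (rule integrable_abs)
  hence "(\<integral>y. mu y * \<bar>ln (dist x y)\<bar> \<partial>lborel) \<le> (\<integral>y. m y \<partial>lborel)"
    using m le by (intro integral_mono) (simp_all add: abs_mult abs_of_pos[OF mu_pos] has_bochner_integral_iff)
  thus ?B using m by (simp add: has_bochner_integral_iff)
qed

lemma mu_bounded_integrable_ln_dist:
  "mu_bounded u \<Longrightarrow> integrable lborel (\<lambda>y. u y * ln (dist x y))"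
  by (rule mu_bounded_integrable_mult[OF _ _ integrable_mu_ln_dist]) simp_all

lemma integrable_mu_mu_ln_dist:
  "integrable (lborel \<Otimes>\<^sub>M lborel) (\<lambda>(x, y). mu x * mu y * ln (dist x y))"
proof (rule lborel_pair.Fubini_integrable)
  show "AE x in lborel. integrable lborel (\<lambda>y. case (x, y) of (x, y) \<Rightarrow> mu x * mu y * ln (dist x y))"
    using integrable_mult_right[OF integrable_mu_ln_dist] by (simp add: mult.assoc)
  show "integrable lborel (\<lambda>x. \<integral>y. norm (case (x, y) of (x, y) \<Rightarrow> mu x * mu y * ln (dist x y)) \<partial>lborel)"
  proof (rule Bochner_Integration.integrable_bound)
    show "integrable lborel (\<lambda>x. mu x * mu_pot x + mu x * (5 / 2 + ln 2 / 2))"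
      using has_bochner_integral_mu has_bochner_integral_mu_mu_pot
      by (auto simp: has_bochner_integral_iff)
    have "\<bar>\<integral>y. \<bar>mu x * mu y * ln (dist x y)\<bar> \<partial>lborel\<bar>
        \<le> \<bar>mu x * mu_pot x + mu x * (5 / 2 + ln 2 / 2)\<bar>" for x
    proof -
      have "(\<integral>y. \<bar>mu x * mu y * ln (dist x y)\<bar> \<partial>lborel)
          = mu x * (\<integral>y. mu y * \<bar>ln (dist x y)\<bar> \<partial>lborel)"
        by (simp add: abs_mult abs_of_pos[OF mu_pos] mult.assoc)
      also have "\<dots> \<le> mu x * (mu_pot x + (5 / 2 + ln 2 / 2))"
        by (intro mult_left_mono integral_mu_abs_ln_dist_le less_imp_le[OF mu_pos])
      finally show ?thesis
        by (simp add: distrib_left abs_of_nonneg integral_nonneg_AE)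
    qed
    thus "AE x in lborel. norm (\<integral>y. norm (case (x, y) of (x, y) \<Rightarrow> mu x * mu y * ln (dist x y)) \<partial>lborel)
        \<le> norm (mu x * mu_pot x + mu x * (5 / 2 + ln 2 / 2))"
      by simp
  qed simp
qed simp

lemma mu_bounded_integrable_pair:
  assumes "mu_bounded u" "mu_bounded v"
  shows "integrable (lborel \<Otimes>\<^sub>M lborel) (\<lambda>(x, y). u x * v y * ln (dist x y))"
proof -
  obtain C D where CD: "\<And>x. \<bar>u x\<bar> \<le> C * mu x" "\<And>x. \<bar>v x\<bar> \<le> D * mu x"
    using assms unfolding mu_bounded_def by blast
  have [measurable]: "u \<in> borel_measurable borel" "v \<in> borel_measurable borel"
    using assms by (auto intro: mu_bounded_measurable)
  show ?thesis
  proof (rule Bochner_Integration.integrable_bound)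
    show "integrable (lborel \<Otimes>\<^sub>M lborel) (\<lambda>p. (C * D) * (case p of (x, y) \<Rightarrow> mu x * mu y * ln (dist x y)))"
      by (intro integrable_mult_right integrable_mu_mu_ln_dist)
    have "\<bar>u x * v y * ln (dist x y)\<bar> \<le> \<bar>(C * D) * (mu x * mu y * ln (dist x y))\<bar>" for x y
    proof -
      have "\<bar>u x\<bar> * \<bar>v y\<bar> * \<bar>ln (dist x y)\<bar> \<le> \<bar>C * mu x\<bar> * \<bar>D * mu y\<bar> * \<bar>ln (dist x y)\<bar>"
        using CD(1)[of x] CD(2)[of y] by (intro mult_right_mono mult_mono) auto
      thus ?thesis by (simp add: abs_mult mult_ac)
    qed
    thus "AE p in lborel \<Otimes>\<^sub>M lborel. norm (case p of (x, y) \<Rightarrow> u x * v y * ln (dist x y))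
        \<le> norm ((C * D) * (case p of (x, y) \<Rightarrow> mu x * mu y * ln (dist x y)))"
      by (auto simp: split_beta)
  qed simp
qed

subsection \<open>Positivity of the logarithmic energy\<close>

text \<open>The two exponentials must be kept together: a single one divided by \<open>t\<close> is
  not integrable near 0. The indicator restricts the integral to positive \<open>t\<close>.\<close>

definition frullani :: "real \<Rightarrow> real \<Rightarrow> real \<Rightarrow> real" where
  "frullani a b t = indicator {0<..} t * ((exp (- (t * a)) - exp (- (t * b))) / t)"

lemma frullani_measurable [measurable (raw)]:
  assumes [measurable]: "f \<in> borel_measurable M" "g \<in> borel_measurable M" "h \<in> borel_measurable M"
  shows "(\<lambda>x. frullani (f x) (g x) (h x)) \<in> borel_measurable M"
  unfolding frullani_def by measurable

lemma frullani_nonneg: "a \<le> b \<Longrightarrow> 0 \<le> frullani a b t"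
  by (simp add: frullani_def indicator_def)

lemma frullani_swap: "frullani b a t = - frullani a b t"
  by (simp add: frullani_def indicator_def field_simps)

lemma has_bochner_integral_exp_Icc:
  fixes a b t :: real
  assumes "a \<le> b" "t \<noteq> 0"
  shows "has_bochner_integral lborel (\<lambda>\<beta>. indicator {a..b} \<beta> * exp (- (t * \<beta>)))
           ((exp (- (t * a)) - exp (- (t * b))) / t)"
proof -
  have "has_bochner_integral lborel (\<lambda>\<beta>. exp (- (t * \<beta>)) * indicator {a..b} \<beta>)
      (- exp (- (t * b)) / t - - exp (- (t * a)) / t)"
    by (rule has_bochner_integral_FTC_Icc_real)
      (use assms in \<open>auto intro!: derivative_eq_intros\<close>)
  thus ?thesis by (simp add: mult.commute diff_divide_distrib)
qed

text \<open>The quotient is the integral of exp(-t \<beta>) over \<beta> in [a,b]. After exchanging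
  the integrals, integration in \<open>t\<close> leaves 1/\<beta>. The order of \<open>a\<close> and
  \<open>b\<close> makes the integrand nonnegative, so Fubini is immediate.\<close>

lemma has_bochner_integral_frullani_le:
  assumes "0 < a" "a \<le> b"
  shows "has_bochner_integral lborel (frullani a b) (ln b - ln a)"
proof -
  define h where "h \<beta> t = indicator {a..b} \<beta> * (indicator {0<..} t * exp (- (\<beta> * t)))" for \<beta> t :: real
  have t: "has_bochner_integral lborel (h \<beta>) (indicator {a..b} \<beta> * (1 / \<beta>))" for \<beta>
    unfolding h_def using has_bochner_integral_exp_Ioi[of \<beta>] assms
    by (cases "\<beta> \<in> {a..b}") auto
  have b: "has_bochner_integral lborel (\<lambda>\<beta>. indicator {a..b} \<beta> * (1 / \<beta>)) (ln b - ln a)"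
  proof -
    have "has_bochner_integral lborel (\<lambda>\<beta>. 1 / \<beta> * indicator {a..b} \<beta>) (ln b - ln a)"
      using assms by (intro has_bochner_integral_FTC_Icc_real)
        (auto intro!: derivative_eq_intros continuous_intros)
    thus ?thesis by (simp add: mult.commute)
  qed
  have b': "(\<integral>\<beta>. h \<beta> t \<partial>lborel) = frullani a b t" for t
    using has_bochner_integral_exp_Icc[OF assms(2), of t]
    by (cases "t > 0") (auto simp: h_def frullani_def has_bochner_integral_iff mult.commute)
  have [measurable]: "case_prod h \<in> borel_measurable (lborel \<Otimes>\<^sub>M lborel)"
    unfolding h_def by measurable
  have int: "integrable (lborel \<Otimes>\<^sub>M lborel) (case_prod h)"
  proof (rule lborel_pair.Fubini_integrable)
    have "norm (h \<beta> t) = h \<beta> t" for \<beta> t by (simp add: h_def)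
    thus "integrable lborel (\<lambda>\<beta>. \<integral>t. norm (case (\<beta>, t) of (\<beta>, t) \<Rightarrow> h \<beta> t) \<partial>lborel)"
      using t b by (simp add: has_bochner_integral_iff)
    show "AE \<beta> in lborel. integrable lborel (\<lambda>t. case (\<beta>, t) of (\<beta>, t) \<Rightarrow> h \<beta> t)"
      using t by (simp add: has_bochner_integral_iff)
  qed simp
  show ?thesis
    using lborel_pair.integrable_snd[OF int] lborel_pair.Fubini_integral[OF int] t b
    by (simp add: b' has_bochner_integral_iff)
qed

lemma has_bochner_integral_frullani:
  assumes "0 < a" "0 < b"
  shows "has_bochner_integral lborel (frullani a b) (ln b - ln a)"
proof (cases "a \<le> b")
  case False
  hence "has_bochner_integral lborel (\<lambda>t. - frullani b a t) (- (ln a - ln b))"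
    using assms by (intro has_bochner_integral_minus has_bochner_integral_frullani_le) auto
  thus ?thesis by (simp add: frullani_swap[of b a])
qed (use assms has_bochner_integral_frullani_le in auto)

lemma integral_abs_frullani:
  assumes "0 < a" "0 < b"
  shows "(\<integral>t. \<bar>frullani a b t\<bar> \<partial>lborel) = \<bar>ln b - ln a\<bar>"
proof (cases "a \<le> b")
  case True
  thus ?thesis using has_bochner_integral_frullani_le[OF assms(1) True] assms
    by (simp add: frullani_nonneg has_bochner_integral_iff)
next
  case False
  hence "\<bar>frullani a b t\<bar> = frullani b a t" for t
    using frullani_nonneg[of b a t] by (simp add: frullani_swap[of b a])
  thus ?thesis using has_bochner_integral_frullani_le[of b a] assms False
    by (simp add: has_bochner_integral_iff)
qed

text \<open>For fixed \<open>p\<close> the Frullani integrand has one sign in \<open>t\<close>, so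
  the integral of its absolute value is \<open>\<bar>ln (b p) - ln (a p)\<bar>\<close>.
  Integrability of the logarithmic integrand is thus all that Fubini asks for. Positivity holds only
  almost everywhere because \<open>a\<close> and \<open>b\<close> will be squared distances.\<close>

lemma integrable_frullani_pair:
  fixes u a b :: "'a::euclidean_space \<Rightarrow> real"
  assumes [measurable]: "u \<in> borel_measurable borel" "a \<in> borel_measurable borel" "b \<in> borel_measurable borel"
    and ab: "AE p in lborel. 0 < a p \<and> 0 < b p"
    and int: "integrable lborel (\<lambda>p. u p * (ln (b p) - ln (a p)))"
  shows "integrable (lborel \<Otimes>\<^sub>M lborel) (\<lambda>(p, t). u p * frullani (a p) (b p) t)"
    and "(\<integral>t. (\<integral>p. u p * frullani (a p) (b p) t \<partial>lborel) \<partial>lborel) = (\<integral>p. u p * (ln (b p) - ln (a p)) \<partial>lborel)"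
proof -
  show int': "integrable (lborel \<Otimes>\<^sub>M lborel) (\<lambda>(p, t). u p * frullani (a p) (b p) t)"
  proof (rule lborel_pair.Fubini_integrable)
    have "AE p in lborel. \<bar>u p * (ln (b p) - ln (a p))\<bar> = (\<integral>t. norm (u p * frullani (a p) (b p) t) \<partial>lborel)"
      using ab by eventually_elim (simp add: abs_mult integral_abs_frullani)
    moreover have "integrable lborel (\<lambda>p. \<bar>u p * (ln (b p) - ln (a p))\<bar>)"
      using int by (rule integrable_abs)
    ultimately have "integrable lborel (\<lambda>p. \<integral>t. norm (u p * frullani (a p) (b p) t) \<partial>lborel)"
      by (subst (asm) integrable_cong_AE) auto
    thus "integrable lborel (\<lambda>p. \<integral>t. norm (case (p, t) of (p, t) \<Rightarrow> u p * frullani (a p) (b p) t) \<partial>lborel)"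
      by simp
    show "AE p in lborel. integrable lborel (\<lambda>t. case (p, t) of (p, t) \<Rightarrow> u p * frullani (a p) (b p) t)"
      using ab
    proof eventually_elim
      case (elim p)
      hence "integrable lborel (frullani (a p) (b p))"
        using has_bochner_integral_frullani[of "a p" "b p"] by (simp add: has_bochner_integral_iff)
      thus ?case by simp
    qed
  qed simp
  have "(\<integral>t. (\<integral>p. u p * frullani (a p) (b p) t \<partial>lborel) \<partial>lborel)
      = (\<integral>p. (\<integral>t. u p * frullani (a p) (b p) t \<partial>lborel) \<partial>lborel)"
    by (rule lborel_pair.Fubini_integral[OF int'])
  also have "\<dots> = (\<integral>p. u p * (ln (b p) - ln (a p)) \<partial>lborel)"
  proof (rule integral_cong_AE)
    show "AE p in lborel. (\<integral>t. u p * frullani (a p) (b p) t \<partial>lborel) = u p * (ln (b p) - ln (a p))"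
      using ab
    proof eventually_elim
      case (elim p)
      thus ?case
        using has_bochner_integral_frullani[of "a p" "b p"] by (simp add: has_bochner_integral_iff)
    qed
  qed simp_all
  finally show "(\<integral>t. (\<integral>p. u p * frullani (a p) (b p) t \<partial>lborel) \<partial>lborel)
      = (\<integral>p. u p * (ln (b p) - ln (a p)) \<partial>lborel)" .
qed

section \<open>Positive definiteness of Gaussian kernels\<close>

lemma has_bochner_integral_pair_mult:
  fixes f :: "'a::euclidean_space \<Rightarrow> real" and g :: "'b::euclidean_space \<Rightarrow> real"
  assumes f: "integrable lborel f" and g: "integrable lborel g"
  shows "has_bochner_integral (lborel \<Otimes>\<^sub>M lborel) (\<lambda>(x, y). f x * g y)
           ((\<integral>x. f x \<partial>lborel) * (\<integral>y. g y \<partial>lborel))"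
proof -
  have [measurable]: "f \<in> borel_measurable borel" "g \<in> borel_measurable borel"
    using borel_measurable_integrable[OF f] borel_measurable_integrable[OF g] by simp_all
  have int: "integrable (lborel \<Otimes>\<^sub>M lborel) (\<lambda>(x, y). f x * g y)"
    by (rule lborel_pair.Fubini_integrable) (use f g in \<open>simp_all add: abs_mult\<close>)
  show ?thesis
    using int lborel_pair.integral_fst[OF int] by (simp add: has_bochner_integral_iff)
qed

text \<open>Up to a positive constant, the Gaussian of rate \<open>t\<close> is the convolution of
  the Gaussian of rate \<open>2 * t\<close> with itself. This factorization of the kernel is what
  makes it positive definite.\<close>

lemma has_bochner_integral_gaussian_convolution:
  fixes x y :: "real^2"
  assumes "t > 0"
  shows "has_bochner_integral lborel
           (\<lambda>z. exp (- (2 * t * (norm (x - z))\<^sup>2)) * exp (- (2 * t * (norm (y - z))\<^sup>2)))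
           (pi / (4 * t) * exp (- (t * (dist x y)\<^sup>2)))"
proof -
  have "has_bochner_integral lborel
      (\<lambda>z. exp (- (2 * t * (norm z)\<^sup>2)) * exp (- (2 * t * (norm ((y - x) - z))\<^sup>2)))
      (pi / (2 * t + 2 * t) * exp (- (2 * t * (2 * t) / (2 * t + 2 * t) * (norm (y - x))\<^sup>2)))"
    using assms by (intro has_bochner_integral_gaussian_product) auto
  moreover have "2 * t * (2 * t) / (2 * t + 2 * t) = t" using assms by (simp add: field_simps)
  moreover have "y - x - z = y - (x + z)" for z by simp
  ultimately have "has_bochner_integral lborel
      (\<lambda>z. exp (- (2 * t * (norm (x - (x + z)))\<^sup>2)) * exp (- (2 * t * (norm (y - (x + z)))\<^sup>2)))
      (pi / (4 * t) * exp (- (t * (dist x y)\<^sup>2)))"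
    by (simp add: dist_norm norm_minus_commute)
  thus ?thesis by (subst (asm) has_bochner_integral_translate)
qed

lemma integrable_gaussian_energy:
  fixes u :: "real^2 \<Rightarrow> real"
  assumes u: "integrable lborel u" and t: "t > 0"
  shows "integrable (lborel \<Otimes>\<^sub>M lborel) (\<lambda>(x, y). u x * u y * exp (- (t * (dist x y)\<^sup>2)))"
proof (rule Bochner_Integration.integrable_bound)
  have [measurable]: "u \<in> borel_measurable borel" using borel_measurable_integrable[OF u] by simp
  show "integrable (lborel \<Otimes>\<^sub>M lborel) (\<lambda>(x, y). u x * u y)"
    using has_bochner_integral_pair_mult[OF u u] by (simp add: has_bochner_integral_iff)
  show "AE p in lborel \<Otimes>\<^sub>M lborel. norm (case p of (x, y) \<Rightarrow> u x * u y * exp (- (t * (dist x y)\<^sup>2)))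
      \<le> norm (case p of (x, y) \<Rightarrow> u x * u y)"
    using t by (intro AE_I2) (auto simp: split_beta abs_mult intro!: mult_left_le)
  show "(\<lambda>(x, y). u x * u y * exp (- (t * (dist x y)\<^sup>2))) \<in> borel_measurable (lborel \<Otimes>\<^sub>M lborel)"
    by measurable
qed

text \<open>With the kernel factored through an auxiliary point \<open>z\<close>, the energy becomes
  a positive multiple of the integral over \<open>z\<close> of a square.\<close>

lemma gaussian_energy_nonneg:
  fixes u :: "real^2 \<Rightarrow> real"
  assumes u: "integrable lborel u" and t: "t > 0"
  shows "0 \<le> (\<integral>(x, y). u x * u y * exp (- (t * (dist x y)\<^sup>2)) \<partial>(lborel \<Otimes>\<^sub>M lborel))"
proof -
  have [measurable]: "u \<in> borel_measurable borel" using borel_measurable_integrable[OF u] by simp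
  define E :: "real^2 \<Rightarrow> real^2 \<Rightarrow> real" where "E x z = exp (- (2 * t * (norm (x - z))\<^sup>2))" for x z
  define h where "h p z = (case p of (x, y) \<Rightarrow> u x * u y * (E x z * E y z))" for p z
  have E_pos: "E x z > 0" for x z by (simp add: E_def)
  have E: "has_bochner_integral lborel (\<lambda>z. E x z * E y z) (pi / (4 * t) * exp (- (t * (dist x y)\<^sup>2)))" for x y
    unfolding E_def using has_bochner_integral_gaussian_convolution[OF t] by simp
  have hz: "has_bochner_integral lborel (h (x, y)) (pi / (4 * t) * (u x * u y * exp (- (t * (dist x y)\<^sup>2))))" for x y
    using has_bochner_integral_mult_right[OF E, of "u x * u y" x y] by (simp add: h_def[abs_def] mult_ac)
  have [measurable]: "case_prod h \<in> borel_measurable ((lborel \<Otimes>\<^sub>M lborel) \<Otimes>\<^sub>M lborel)"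
    unfolding h_def E_def by measurable
  \<comment> \<open>The pair (x,y) is treated as a single variable with Lebesgue measure on the
    product space, so that the exchange with \<open>z\<close> is an ordinary two-variable
    Fubini.\<close>
  have meas2 [measurable]: "case_prod h \<in> borel_measurable (lborel \<Otimes>\<^sub>M lborel)"
    using \<open>case_prod h \<in> borel_measurable ((lborel \<Otimes>\<^sub>M lborel) \<Otimes>\<^sub>M lborel)\<close> by (simp only: lborel_prod)
  note gauss = integrable_gaussian_energy[OF u t, unfolded lborel_prod]
  have int: "integrable (lborel \<Otimes>\<^sub>M lborel) (case_prod h)"
  proof (rule lborel_pair.Fubini_integrable)
    \<comment> \<open>The factors \<open>E\<close> are positive, so the absolute value falls on
      \<open>u x * u y\<close> alone and the Fubini condition reduces to integrability of the
      Gaussian energy.\<close>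
    have "(\<integral>z. norm (h p z) \<partial>lborel) = \<bar>pi / (4 * t) * (case p of (x, y) \<Rightarrow> u x * u y * exp (- (t * (dist x y)\<^sup>2)))\<bar>" for p
    proof -
      obtain x y where p: "p = (x, y)" by fastforce
      have "norm (h p z) = \<bar>u x * u y\<bar> * (E x z * E y z)" for z
        using E_pos[of x z] E_pos[of y z] by (simp add: p h_def abs_mult)
      hence "(\<integral>z. norm (h p z) \<partial>lborel) = \<bar>u x * u y\<bar> * (pi / (4 * t) * exp (- (t * (dist x y)\<^sup>2)))"
        using E[of x y] by (simp add: has_bochner_integral_iff)
      thus ?thesis using t by (simp add: p abs_mult)
    qed
    thus "integrable lborel (\<lambda>p. \<integral>z. norm (case (p, z) of (p, z) \<Rightarrow> h p z) \<partial>lborel)"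
      using gauss by (simp del: abs_mult)
    show "AE p in lborel. integrable lborel (\<lambda>z. case (p, z) of (p, z) \<Rightarrow> h p z)"
      using hz by (auto simp: has_bochner_integral_iff)
  qed simp
  have sq: "(\<integral>p. h p z \<partial>lborel) = (\<integral>x. u x * E x z \<partial>lborel)\<^sup>2" for z
  proof -
    have "integrable lborel (\<lambda>x. u x * E x z)"
    proof (rule Bochner_Integration.integrable_bound[OF u])
      show "AE x in lborel. norm (u x * E x z) \<le> norm (u x)"
        using t by (auto simp: abs_mult E_def intro!: mult_left_le)
    qed (simp add: E_def)
    from has_bochner_integral_pair_mult[OF this this]
    have "has_bochner_integral lborel (\<lambda>(x, y). u x * E x z * (u y * E y z)) ((\<integral>x. u x * E x z \<partial>lborel)\<^sup>2)"
      by (simp add: lborel_prod power2_eq_square)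
    also have "(\<lambda>(x, y). u x * E x z * (u y * E y z)) = (\<lambda>p. h p z)"
      by (auto simp: h_def mult_ac)
    finally show ?thesis by (simp add: has_bochner_integral_iff)
  qed
  have "(\<integral>p. (\<integral>z. h p z \<partial>lborel) \<partial>lborel) = (\<integral>z. (\<integral>p. h p z \<partial>lborel) \<partial>lborel)"
    by (rule lborel_pair.Fubini_integral[OF int, symmetric])
  also have "\<dots> \<ge> 0" by (simp add: sq)
  finally have "0 \<le> (\<integral>p. (\<integral>z. h p z \<partial>lborel) \<partial>lborel)" .
  also have "(\<lambda>p. \<integral>z. h p z \<partial>lborel) = (\<lambda>p. pi / (4 * t) * (case p of (x, y) \<Rightarrow> u x * u y * exp (- (t * (dist x y)\<^sup>2))))"
    using hz by (auto simp: has_bochner_integral_iff)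
  finally have "0 \<le> pi / (4 * t) * (\<integral>(x, y). u x * u y * exp (- (t * (dist x y)\<^sup>2)) \<partial>lborel)"
    by simp
  moreover have "0 < pi / (4 * t)" using t by simp
  ultimately show ?thesis
    unfolding lborel_prod using mult_le_cancel_left_pos[of "pi / (4 * t)" 0] by simp
qed

lemma AE_lborel_pair_neq: "AE p in lborel \<Otimes>\<^sub>M (lborel :: (real^2) measure). fst p \<noteq> snd p"
proof (rule lborel_pair.AE_pair_measure)
  show "AE x in lborel. AE y in lborel. fst (x::real^2, y) \<noteq> snd (x, y)"
    using AE_lborel_singleton by (auto simp: eq_commute)
qed measurable

lemma log_energy_nonpos:
  assumes u: "mu_bounded u" and zero: "(\<integral>x. u x \<partial>lborel) = 0"
  shows "(\<integral>(x, y). u x * u y * ln (dist x y) \<partial>(lborel \<Otimes>\<^sub>M lborel)) \<le> 0"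
proof -
  have [measurable]: "u \<in> borel_measurable borel" by (rule mu_bounded_measurable[OF u])
  note iu = mu_bounded_integrable[OF u]
  define U where "U p = u (fst p) * u (snd p)" for p
  define a where "a p = (dist (fst p) (snd p))\<^sup>2" for p :: "(real^2) \<times> (real^2)"
  have [measurable]: "U \<in> borel_measurable borel" "a \<in> borel_measurable borel"
    unfolding U_def a_def borel_prod[symmetric] by measurable
  \<comment> \<open>Frullani is applied to the squared distance, which makes the Gaussians quadratic
    and produces the factor -2. Any positive second parameter would do; 1 has logarithm 0. On the
    diagonal both sides are 0.\<close>
  have eq: "U p * (ln 1 - ln (a p)) = - 2 * (case p of (x, y) \<Rightarrow> u x * u y * ln (dist x y))" for p
    by (cases "fst p = snd p") (auto simp: U_def a_def split_beta ln_realpow)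
  have int: "integrable lborel (\<lambda>p. U p * (ln 1 - ln (a p)))"
    unfolding eq using mu_bounded_integrable_pair[OF u u] unfolding lborel_prod by simp
  have "- 2 * (\<integral>(x, y). u x * u y * ln (dist x y) \<partial>lborel) = (\<integral>p. U p * (ln 1 - ln (a p)) \<partial>lborel)"
    unfolding eq by simp
  also have "\<dots> = (\<integral>t. (\<integral>p. U p * frullani (a p) 1 t \<partial>lborel) \<partial>lborel)"
  proof (rule integrable_frullani_pair(2)[symmetric])
    show "AE p in lborel. 0 < a p \<and> 0 < (1::real)"
      using AE_lborel_pair_neq unfolding lborel_prod by eventually_elim (simp add: a_def)
  qed (use int in simp_all)
  also have "\<dots> \<ge> 0"
  proof (rule integral_nonneg_AE, rule AE_I2)
    fix t :: real
    show "0 \<le> (\<integral>p. U p * frullani (a p) 1 t \<partial>lborel)"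
    proof (cases "t > 0")
      case True
      have g: "integrable lborel (\<lambda>(x, y). u x * u y * exp (- (t * (dist x y)\<^sup>2)))"
        using integrable_gaussian_energy[OF iu True] by (simp add: lborel_prod)
      \<comment> \<open>Mean zero enters here: the constant kernel \<open>exp (- t)\<close>
        contributes a multiple of the squared integral of \<open>u\<close>.\<close>
      have c: "has_bochner_integral lborel (\<lambda>(x, y). u x * u y) 0"
        using has_bochner_integral_pair_mult[OF iu iu] by (simp add: lborel_prod zero)
      have "(\<integral>p. U p * frullani (a p) 1 t \<partial>lborel) = (\<integral>p. 1 / t *
          ((case p of (x, y) \<Rightarrow> u x * u y * exp (- (t * (dist x y)\<^sup>2)))
             - exp (- t) * (case p of (x, y) \<Rightarrow> u x * u y)) \<partial>lborel)"
        using True by (intro Bochner_Integration.integral_cong)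
          (auto simp: U_def a_def frullani_def field_simps)
      also have "\<dots> = 1 / t * (\<integral>(x, y). u x * u y * exp (- (t * (dist x y)\<^sup>2)) \<partial>lborel)"
        using g c by (simp add: has_bochner_integral_iff)
      also have "\<dots> \<ge> 0"
        using gaussian_energy_nonneg[OF iu True] True by (simp add: lborel_prod)
      finally show ?thesis .
    qed (simp add: frullani_def)
  qed
  finally show ?thesis by (simp add: lborel_prod)
qed

subsection \<open>The logarithmic potential of the weight\<close>

lemma nn_integral_eq_has_bochner_integral:
  fixes f :: "'a \<Rightarrow> real"
  assumes "has_bochner_integral M f I" "\<And>x. 0 \<le> f x"
  shows "(\<integral>\<^sup>+x. ennreal (f x) \<partial>M) = ennreal I"
  using assms by (subst nn_integral_eq_integral) (auto simp: has_bochner_integral_iff)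

text \<open>With \<open>c\<close> equal to 1 + |y|^2 this exhibits \<open>mu\<close> as a mixture of
  centred Gaussians.\<close>

lemma has_bochner_integral_times_exp_Ioi:
  assumes "(c::real) > 0"
  shows "has_bochner_integral lborel (\<lambda>s. indicator {0<..} s * (s * exp (- (c * s)))) (1 / c\<^sup>2)"
proof -
  have "has_bochner_integral lborel (\<lambda>s. indicator {0<..} s * (s * exp (- (c * s)))) (0 - (- 1 / c\<^sup>2))"
  proof (rule has_bochner_integral_FTC_Ioi[where F = "\<lambda>s. - (c * s + 1) * exp (- (c * s)) / c\<^sup>2"])
    show "((\<lambda>s. - (c * s + 1) * exp (- (c * s)) / c\<^sup>2) \<longlongrightarrow> - 1 / c\<^sup>2) (at_right 0)"
      by (rule tendsto_eq_intros refl | use assms in simp)+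
    show "((\<lambda>s. - (c * s + 1) * exp (- (c * s)) / c\<^sup>2) \<longlongrightarrow> 0) at_top"
      using assms by real_asymp
    show "((\<lambda>s. - (c * s + 1) * exp (- (c * s)) / c\<^sup>2) has_real_derivative s * exp (- (c * s))) (at s)" for s
    proof -
      have "((\<lambda>s. - (c * s + 1) * exp (- (c * s)) / c\<^sup>2) has_real_derivative
          (- c * exp (- (c * s)) + - (c * s + 1) * (exp (- (c * s)) * - c)) / c\<^sup>2) (at s)"
        using assms by (intro DERIV_cdivide) (auto intro!: derivative_eq_intros simp: algebra_simps)
      also have "(- c * exp (- (c * s)) + - (c * s + 1) * (exp (- (c * s)) * - c)) = c\<^sup>2 * (s * exp (- (c * s)))"
        by (simp add: power2_eq_square algebra_simps)
      finally show ?thesis using assms by simp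
    qed
  qed (auto intro!: continuous_intros)
  thus ?thesis by simp
qed

text \<open>Each Gaussian component of \<open>mu\<close>, of rate \<open>s\<close>, is integrated
  against the Gaussian centred at \<open>x\<close> by completing the square; \<open>k s\<close> is
  the contribution of that component.\<close>

lemma has_bochner_integral_mu_gaussian:
  fixes x :: "real^2"
  assumes "t \<ge> 0"
  defines "k \<equiv> \<lambda>s. indicator {0<..} s * (exp (- s) * (s / (s + t) * exp (- (s * t / (s + t) * (norm x)\<^sup>2))))"
  shows "integrable lborel k"
    and "has_bochner_integral lborel (\<lambda>y. mu y * exp (- (t * (norm (x - y))\<^sup>2))) (\<integral>s. k s \<partial>lborel)"
proof -
  have [measurable]: "k \<in> borel_measurable borel" unfolding k_def by measurable
  \<comment> \<open>Integrating in \<open>s\<close> restores \<open>mu y\<close> times the Gaussian,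
    integrating in \<open>y\<close> gives \<open>k s\<close>; Fubini equates the two
    results.\<close>
  define h where "h s y = (indicator {0<..} s * (s * exp (- s) / pi)) *
      (exp (- (s * (norm y)\<^sup>2)) * exp (- (t * (norm (x - y))\<^sup>2)))" for s :: real and y
  have hy: "has_bochner_integral lborel (h s) (k s)" for s
  proof (cases "s > 0")
    case True
    have "has_bochner_integral lborel (h s) ((indicator {0<..} s * (s * exp (- s) / pi)) *
        (pi / (s + t) * exp (- (s * t / (s + t) * (norm x)\<^sup>2))))"
      unfolding h_def using True assms by (intro has_bochner_integral_mult_right has_bochner_integral_gaussian_product)
    also have "(indicator {0<..} s * (s * exp (- s) / pi)) *
        (pi / (s + t) * exp (- (s * t / (s + t) * (norm x)\<^sup>2))) = k s"
      by (simp add: k_def)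
    finally show ?thesis .
  qed (simp add: h_def[abs_def] k_def has_bochner_integral_zero)
  have hs: "has_bochner_integral lborel (\<lambda>s. h s y) (mu y * exp (- (t * (norm (x - y))\<^sup>2)))" for y
  proof -
    have "has_bochner_integral lborel
        (\<lambda>s. exp (- (t * (norm (x - y))\<^sup>2)) / pi * (indicator {0<..} s * (s * exp (- ((1 + (norm y)\<^sup>2) * s)))))
        (exp (- (t * (norm (x - y))\<^sup>2)) / pi * (1 / (1 + (norm y)\<^sup>2)\<^sup>2))"
      by (intro has_bochner_integral_mult_right has_bochner_integral_times_exp_Ioi one_plus_norm_sq_pos)
    also have "exp (- (t * (norm (x - y))\<^sup>2)) / pi * (1 / (1 + (norm y)\<^sup>2)\<^sup>2) = mu y * exp (- (t * (norm (x - y))\<^sup>2))"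
      by (simp add: mu_def)
    also have "(\<lambda>s. exp (- (t * (norm (x - y))\<^sup>2)) / pi * (indicator {0<..} s * (s * exp (- ((1 + (norm y)\<^sup>2) * s)))))
        = (\<lambda>s. h s y)"
      by (auto simp: h_def fun_eq_iff algebra_simps exp_add exp_diff exp_minus divide_simps)
    finally show ?thesis .
  qed
  show k: "integrable lborel k"
  proof (rule Bochner_Integration.integrable_bound)
    show "integrable lborel (\<lambda>s::real. indicator {0<..} s * exp (- (1 * s)))"
      using has_bochner_integral_exp_Ioi[of 1] by (simp add: has_bochner_integral_iff)
    have "\<bar>k s\<bar> \<le> indicator {0<..} s * exp (- s)" for s
    proof (cases "s > 0")
      case True
      define r where "r = s / (s + t) * exp (- (s * t / (s + t) * (norm x)\<^sup>2))"
      have "0 \<le> r" "r \<le> 1"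
        unfolding r_def using True assms(1) by (simp, intro mult_le_one) simp_all
      moreover have "k s = exp (- s) * r" using True by (simp add: k_def r_def)
      ultimately show ?thesis using True by (simp add: abs_mult mult_left_le)
    qed (simp add: k_def)
    thus "AE s in lborel. norm (k s) \<le> norm (indicator {0<..} s * exp (- (1 * s)))"
      by (simp add: abs_mult)
  qed simp
  have [measurable]: "case_prod h \<in> borel_measurable (lborel \<Otimes>\<^sub>M lborel)"
    unfolding h_def by measurable
  have int: "integrable (lborel \<Otimes>\<^sub>M lborel) (case_prod h)"
  proof (rule lborel_pair.Fubini_integrable)
    have "norm (h s y) = h s y" for s y by (simp add: h_def indicator_def)
    thus "integrable lborel (\<lambda>s. \<integral>y. norm (case (s, y) of (s, y) \<Rightarrow> h s y) \<partial>lborel)"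
      using hy k by (simp add: has_bochner_integral_iff)
    show "AE s in lborel. integrable lborel (\<lambda>y. case (s, y) of (s, y) \<Rightarrow> h s y)"
      using hy by (simp add: has_bochner_integral_iff)
  qed simp
  show "has_bochner_integral lborel (\<lambda>y. mu y * exp (- (t * (norm (x - y))\<^sup>2))) (\<integral>s. k s \<partial>lborel)"
    using lborel_pair.integrable_snd[OF int] lborel_pair.Fubini_integral[OF int] hy hs
    by (simp add: has_bochner_integral_iff)
qed

text \<open>With \<open>q = s t / (s + t)\<close> the inner integrals become elementary after writing
  \<open>1 - exp (- c q) = \<integral>\<^sub>0\<^sup>c q exp (- \<beta> q) d\<beta>\<close>.\<close>
lemma nn_integral_potential:
  assumes "c \<ge> 0"
  defines "\<Psi> \<equiv> \<lambda>s t::real. indicator {0<..} t * (indicator {0<..} s *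
      (exp (- s) * (s / (s + t) * (1 - exp (- (s * t / (s + t) * c))) / t)))"
  shows "(\<integral>\<^sup>+t. (\<integral>\<^sup>+s. ennreal (\<Psi> s t) \<partial>lborel) \<partial>lborel) = ennreal (ln (1 + c))"
proof -
  \<comment> \<open>The factor q cancels the denominator \<open>t\<close>: s/(s+t) times q/t is
    (s/(s+t))^2. This is also dq/dt, so integration in \<open>t\<close> will be exact.\<close>
  define \<Theta> where "\<Theta> \<beta> s t = indicator {0..c} \<beta> * (indicator {0<..} s * (indicator {0<..} t *
      (exp (- s) * ((s / (s + t))\<^sup>2 * exp (- (s * t / (s + t) * \<beta>))))))" for \<beta> s t :: real
  have [measurable (raw)]: "(\<lambda>x. \<Theta> (f x) (g x) (h x)) \<in> borel_measurable N"
    if [measurable]: "f \<in> borel_measurable N" "g \<in> borel_measurable N" "h \<in> borel_measurable N"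
    for f g h and N :: "'n measure"
    unfolding \<Theta>_def by measurable
  have \<Theta>_nonneg: "0 \<le> \<Theta> \<beta> s t" for \<beta> s t by (simp add: \<Theta>_def)
  have b: "(\<integral>\<^sup>+\<beta>. ennreal (\<Theta> \<beta> s t) \<partial>lborel) = ennreal (\<Psi> s t)" for s t
  proof (cases "s > 0 \<and> t > 0")
    case True
    define q where "q = s * t / (s + t)"
    have q: "q > 0" using True by (simp add: q_def)
    have "has_bochner_integral lborel (\<lambda>\<beta>. exp (- s) * (s / (s + t))\<^sup>2 * (indicator {0..c} \<beta> * exp (- (q * \<beta>))))
        (exp (- s) * (s / (s + t))\<^sup>2 * ((exp (- (q * 0)) - exp (- (q * c))) / q))"
      using assms(1) q by (intro has_bochner_integral_mult_right has_bochner_integral_exp_Icc) auto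
    also have "(\<lambda>\<beta>. exp (- s) * (s / (s + t))\<^sup>2 * (indicator {0..c} \<beta> * exp (- (q * \<beta>)))) = (\<lambda>\<beta>. \<Theta> \<beta> s t)"
      using True by (simp add: \<Theta>_def q_def fun_eq_iff)
    also have "exp (- s) * (s / (s + t))\<^sup>2 * ((exp (- (q * 0)) - exp (- (q * c))) / q) = \<Psi> s t"
    proof -
      have "(s / (s + t))\<^sup>2 / q = s / (s + t) / t"
        using True by (simp add: q_def power2_eq_square divide_simps)
      hence "exp (- s) * ((s / (s + t))\<^sup>2 / q) * (1 - exp (- (q * c)))
          = exp (- s) * (s / (s + t) / t) * (1 - exp (- (q * c)))" by simp
      thus ?thesis unfolding \<Psi>_def q_def[symmetric] using True by simp
    qed
    finally show ?thesis
      using \<Theta>_nonneg by (rule nn_integral_eq_has_bochner_integral)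
  next
    case False
    thus ?thesis by (auto simp: \<Theta>_def \<Psi>_def)
  qed
  \<comment> \<open>As \<open>t\<close> runs from 0 to infinity, q increases from 0 to
    \<open>s\<close>, so this is the integral of exp(-\<beta> q) dq. Dividing by \<beta> requires
    \<beta> > 0, which excludes only a null set of the relevant interval.\<close>
  have t: "(\<integral>\<^sup>+t. ennreal (\<Theta> \<beta> s t) \<partial>lborel)
      = ennreal (indicator {0..c} \<beta> * (indicator {0<..} s * (exp (- s) * (1 - exp (- (s * \<beta>))) / \<beta>)))"
    if "\<beta> > 0" for \<beta> s
  proof (cases "s > 0")
    case True
    have "has_bochner_integral lborel
        (\<lambda>t. indicator {0<..} t * ((s / (s + t))\<^sup>2 * exp (- (s * t / (s + t) * \<beta>))))
        (- exp (- (s * \<beta>)) / \<beta> - (- 1 / \<beta>))"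
    proof (rule has_bochner_integral_FTC_Ioi[where F = "\<lambda>t. - exp (- (s * t / (s + t) * \<beta>)) / \<beta>"])
      show "((\<lambda>t. - exp (- (s * t / (s + t) * \<beta>)) / \<beta>) \<longlongrightarrow> - 1 / \<beta>) (at_right 0)"
        by (rule tendsto_eq_intros refl | use that True in simp)+
      have "((\<lambda>t. s * t / (s + t)) \<longlongrightarrow> s) at_top"
        using True by real_asymp
      thus "((\<lambda>t. - exp (- (s * t / (s + t) * \<beta>)) / \<beta>) \<longlongrightarrow> - exp (- (s * \<beta>)) / \<beta>) at_top"
        using that by (intro tendsto_intros) auto
      fix t :: real assume t: "0 < t"
      define g where "g t = s * t / (s + t)" for t
      have "(g has_real_derivative (s * (s + t) - s * t * 1) / ((s + t) * (s + t))) (at t)"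
        unfolding g_def using True t by (auto intro!: derivative_eq_intros)
      hence g: "(g has_real_derivative (s / (s + t))\<^sup>2) (at t)"
        by (simp add: power2_eq_square algebra_simps)
      have "((\<lambda>t. - exp (- (g t * \<beta>)) / \<beta>) has_real_derivative
          - (exp (- (g t * \<beta>)) * - ((s / (s + t))\<^sup>2 * \<beta>)) / \<beta>) (at t)"
        by (intro DERIV_cdivide DERIV_minus DERIV_fun_exp DERIV_cmult_right g)
      thus "((\<lambda>t. - exp (- (s * t / (s + t) * \<beta>)) / \<beta>) has_real_derivative
          (s / (s + t))\<^sup>2 * exp (- (s * t / (s + t) * \<beta>))) (at t)"
        using that by (simp add: g_def mult.commute)
      show "isCont (\<lambda>t. (s / (s + t))\<^sup>2 * exp (- (s * t / (s + t) * \<beta>))) t"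
        using True t by (intro continuous_intros) auto
    qed auto
    from has_bochner_integral_mult_right[OF this, of "indicator {0..c} \<beta> * exp (- s)"]
    have "has_bochner_integral lborel (\<Theta> \<beta> s)
       (indicator {0..c} \<beta> * (indicator {0<..} s * (exp (- s) * (1 - exp (- (s * \<beta>))) / \<beta>)))"
      using True by (simp add: \<Theta>_def[abs_def] mult_ac right_diff_distrib diff_divide_distrib)
    thus ?thesis
      using \<Theta>_nonneg by (rule nn_integral_eq_has_bochner_integral)
  qed (simp add: \<Theta>_def)
  \<comment> \<open>The difference of two exponential integrals, 1 - 1/(1+\<beta>) =
    \<beta>/(1+\<beta>), cancels the division by \<beta>; what remains integrates to
    \<open>ln (1 + c)\<close>.\<close>
  have s: "(\<integral>\<^sup>+s. ennreal (indicator {0..c} \<beta> * (indicator {0<..} s * (exp (- s) * (1 - exp (- (s * \<beta>))) / \<beta>))) \<partial>lborel)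
      = ennreal (indicator {0..c} \<beta> * (1 / (1 + \<beta>)))" if "\<beta> > 0" for \<beta>
  proof (rule nn_integral_eq_has_bochner_integral)
    have "has_bochner_integral lborel (\<lambda>s::real. indicator {0..c} \<beta> / \<beta> *
        (indicator {0<..} s * exp (- (1 * s)) - indicator {0<..} s * exp (- ((1 + \<beta>) * s))))
        (indicator {0..c} \<beta> / \<beta> * (1 / 1 - 1 / (1 + \<beta>)))"
      using that by (intro has_bochner_integral_mult_right has_bochner_integral_diff has_bochner_integral_exp_Ioi) auto
    also have "indicator {0..c} \<beta> / \<beta> * (1 / 1 - 1 / (1 + \<beta>)) = indicator {0..c} \<beta> * (1 / (1 + \<beta>))"
    proof -
      have "1 / 1 - 1 / (1 + \<beta>) = \<beta> / (1 + \<beta>)" using that by (simp add: field_simps)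
      thus ?thesis using that by simp
    qed
    also have "(\<lambda>s::real. indicator {0..c} \<beta> / \<beta> *
        (indicator {0<..} s * exp (- (1 * s)) - indicator {0<..} s * exp (- ((1 + \<beta>) * s))))
        = (\<lambda>s. indicator {0..c} \<beta> * (indicator {0<..} s * (exp (- s) * (1 - exp (- (s * \<beta>))) / \<beta>)))"
    proof
      fix s :: real
      have "exp (- ((1 + \<beta>) * s)) = exp (- s) * exp (- (s * \<beta>))"
        unfolding exp_add[symmetric] by (simp add: algebra_simps)
      thus "indicator {0..c} \<beta> / \<beta> *
        (indicator {0<..} s * exp (- (1 * s)) - indicator {0<..} s * exp (- ((1 + \<beta>) * s)))
        = indicator {0..c} \<beta> * (indicator {0<..} s * (exp (- s) * (1 - exp (- (s * \<beta>))) / \<beta>))"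
        by (simp add: algebra_simps diff_divide_distrib)
    qed
    finally show "has_bochner_integral lborel
        (\<lambda>s. indicator {0..c} \<beta> * (indicator {0<..} s * (exp (- s) * (1 - exp (- (s * \<beta>))) / \<beta>)))
        (indicator {0..c} \<beta> * (1 / (1 + \<beta>)))" .
  qed (use that in \<open>auto simp: indicator_def\<close>)
  have "(\<integral>\<^sup>+t. (\<integral>\<^sup>+s. ennreal (\<Psi> s t) \<partial>lborel) \<partial>lborel)
      = (\<integral>\<^sup>+t. (\<integral>\<^sup>+s. (\<integral>\<^sup>+\<beta>. ennreal (\<Theta> \<beta> s t) \<partial>lborel) \<partial>lborel) \<partial>lborel)"
    by (simp add: b)
  \<comment> \<open>Three exchanges move the \<beta> integral outermost and the \<open>t\<close>
    integral innermost. With nonnegative integrals none of them needs an integrability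
    proof.\<close>
  also have "\<dots> = (\<integral>\<^sup>+s. (\<integral>\<^sup>+t. (\<integral>\<^sup>+\<beta>. ennreal (\<Theta> \<beta> s t) \<partial>lborel) \<partial>lborel) \<partial>lborel)"
    by (rule lborel_pair.Fubini') simp
  also have "\<dots> = (\<integral>\<^sup>+s. (\<integral>\<^sup>+\<beta>. (\<integral>\<^sup>+t. ennreal (\<Theta> \<beta> s t) \<partial>lborel) \<partial>lborel) \<partial>lborel)"
    by (intro nn_integral_cong lborel_pair.Fubini') simp
  also have "\<dots> = (\<integral>\<^sup>+\<beta>. (\<integral>\<^sup>+s. (\<integral>\<^sup>+t. ennreal (\<Theta> \<beta> s t) \<partial>lborel) \<partial>lborel) \<partial>lborel)"
    by (rule lborel_pair.Fubini') simp
  also have "\<dots> = (\<integral>\<^sup>+\<beta>. ennreal (indicator {0..c} \<beta> * (1 / (1 + \<beta>))) \<partial>lborel)"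
  proof (rule nn_integral_cong_AE)
    have "AE \<beta> in lborel. \<beta> \<noteq> (0::real)" by (rule AE_lborel_singleton)
    thus "AE \<beta> in lborel. (\<integral>\<^sup>+s. (\<integral>\<^sup>+t. ennreal (\<Theta> \<beta> s t) \<partial>lborel) \<partial>lborel)
        = ennreal (indicator {0..c} \<beta> * (1 / (1 + \<beta>)))"
    proof eventually_elim
      case (elim \<beta>)
      show ?case
      proof (cases "\<beta> > 0")
        case True
        thus ?thesis by (simp only: t s)
      next
        case False
        thus ?thesis using elim by (simp add: \<Theta>_def)
      qed
    qed
  qed
  also have "\<dots> = ennreal (ln (1 + c))"
  proof (rule nn_integral_eq_has_bochner_integral)
    have "has_bochner_integral lborel (\<lambda>\<beta>. 1 / (1 + \<beta>) * indicator {0..c} \<beta>) (ln (1 + c) - ln (1 + 0))"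
      by (rule has_bochner_integral_FTC_Icc_real[where F = "\<lambda>\<beta>. ln (1 + \<beta>)"])
        (use assms(1) in \<open>auto intro!: derivative_eq_intros continuous_intros\<close>)
    thus "has_bochner_integral lborel (\<lambda>\<beta>. indicator {0..c} \<beta> * (1 / (1 + \<beta>))) (ln (1 + c))"
      by (simp add: mult.commute)
  qed (use assms(1) in \<open>auto simp: indicator_def\<close>)
  finally show ?thesis .
qed

text \<open>The potential at the origin is 0, so it suffices to compute the difference between
  \<open>x\<close> and the origin. Frullani turns it into a difference of Gaussian averages of
  \<open>mu\<close>, whose \<open>t\<close> integral has already been evaluated.\<close>

lemma potential_mu: "(\<integral>y. mu y * ln (dist x y) \<partial>lborel) = mu_pot x"
proof -
  define c where "c = (norm x)\<^sup>2"
  define \<Psi> where "\<Psi> s t = indicator {0<..} t * (indicator {0<..} s *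
      (exp (- s) * (s / (s + t) * (1 - exp (- (s * t / (s + t) * c))) / t)))" for s t :: real
  define a b where "a y = (norm y)\<^sup>2" and "b y = (norm (x - y))\<^sup>2" for y :: "real^2"
  have [measurable]: "a \<in> borel_measurable borel" "b \<in> borel_measurable borel"
    unfolding a_def b_def by measurable
  \<comment> \<open>Squared distances give the factor 2; the exceptional points \<open>y = 0\<close>
    and \<open>y = x\<close> agree because \<open>ln 0 = 0\<close>.\<close>
  have eq: "mu y * (ln (b y) - ln (a y)) = 2 * (mu y * ln (dist x y) - mu y * ln (norm y))" for y
    by (cases "y = 0"; cases "y = x") (auto simp: a_def b_def ln_realpow dist_norm algebra_simps)
  have int: "has_bochner_integral lborel (\<lambda>y. mu y * (ln (b y) - ln (a y))) (2 * ((\<integral>y. mu y * ln (dist x y) \<partial>lborel) - 0))"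
    unfolding eq
    by (intro has_bochner_integral_mult_right has_bochner_integral_diff has_bochner_integral_mu_ln_norm
        has_bochner_integral_integrable integrable_mu_ln_dist)
  have \<Psi>: "integrable lborel (\<lambda>s. \<Psi> s t)" "(\<integral>y. mu y * frullani (a y) (b y) t \<partial>lborel) = (\<integral>s. \<Psi> s t \<partial>lborel)" for t
  proof (atomize (full), cases "t > 0")
    case True
    define k where "k z s = indicator {0<..} s * (exp (- s) * (s / (s + t) * exp (- (s * t / (s + t) * (norm z)\<^sup>2))))"
      for z :: "real^2" and s
    have k: "integrable lborel (k z)" 
        "has_bochner_integral lborel (\<lambda>y. mu y * exp (- (t * (norm (z - y))\<^sup>2))) (\<integral>s. k z s \<partial>lborel)" for z
      using has_bochner_integral_mu_gaussian[of t z] True unfolding k_def by auto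
    \<comment> \<open>For centre 0 the factor exp(-q|z|^2) is 1, which accounts for the 1 in
      \<open>\<Psi>\<close>.\<close>
    have *: "\<Psi> s t = 1 / t * (k 0 s - k x s)" for s
      using True by (simp add: \<Psi>_def k_def c_def indicator_def algebra_simps diff_divide_distrib)
    have "(\<integral>y. mu y * frullani (a y) (b y) t \<partial>lborel)
        = (\<integral>y. 1 / t * (mu y * exp (- (t * (norm (0 - y))\<^sup>2)) - mu y * exp (- (t * (norm (x - y))\<^sup>2))) \<partial>lborel)"
      using True by (intro Bochner_Integration.integral_cong)
        (auto simp: frullani_def a_def b_def algebra_simps diff_divide_distrib)
    also have "\<dots> = 1 / t * ((\<integral>s. k 0 s \<partial>lborel) - (\<integral>s. k x s \<partial>lborel))"
      using k(2)[of 0] k(2)[of x] by (simp add: has_bochner_integral_iff)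
    also have "\<dots> = (\<integral>s. \<Psi> s t \<partial>lborel)"
      unfolding * using k(1) by simp
    finally show "integrable lborel (\<lambda>s. \<Psi> s t) \<and>
        (\<integral>y. mu y * frullani (a y) (b y) t \<partial>lborel) = (\<integral>s. \<Psi> s t \<partial>lborel)"
      unfolding * using k(1) by simp
  qed (simp add: \<Psi>_def frullani_def)
  have \<Psi>_nonneg: "\<Psi> s t \<ge> 0" for s t
    by (auto simp: \<Psi>_def indicator_def c_def intro!: mult_nonneg_nonneg divide_nonneg_nonneg)
  have [measurable]: "case_prod \<Psi> \<in> borel_measurable (borel \<Otimes>\<^sub>M borel)"
    unfolding \<Psi>_def by measurable
  \<comment> \<open>Nonnegativity of \<open>\<Psi>\<close> allows the iterated Bochner integral to
    be read off from the nonnegative one.\<close>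
  have "(\<integral>\<^sup>+t. ennreal (\<integral>s. \<Psi> s t \<partial>lborel) \<partial>lborel) = (\<integral>\<^sup>+t. (\<integral>\<^sup>+s. ennreal (\<Psi> s t) \<partial>lborel) \<partial>lborel)"
    using \<Psi>(1) \<Psi>_nonneg by (simp add: nn_integral_eq_integral)
  also have "\<dots> = ennreal (ln (1 + c))"
    unfolding \<Psi>_def by (rule nn_integral_potential) (simp add: c_def)
  finally have "(\<integral>t. (\<integral>s. \<Psi> s t \<partial>lborel) \<partial>lborel) = ln (1 + c)"
    using \<Psi>_nonneg
    by (subst integral_eq_nn_integral) (auto simp: c_def integral_nonneg_AE)
  moreover have "(\<integral>t. (\<integral>y. mu y * frullani (a y) (b y) t \<partial>lborel) \<partial>lborel)
      = (\<integral>y. mu y * (ln (b y) - ln (a y)) \<partial>lborel)"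
  proof (rule integrable_frullani_pair(2))
    show "AE y in lborel. 0 < a y \<and> 0 < b y"
      using AE_lborel_singleton[of 0] AE_lborel_singleton[of x]
      by eventually_elim (simp add: a_def b_def)
    show "integrable lborel (\<lambda>y. mu y * (ln (b y) - ln (a y)))"
      using int by (simp add: has_bochner_integral_iff)
  qed simp_all
  ultimately have "ln (1 + c) = 2 * (\<integral>y. mu y * ln (dist x y) \<partial>lborel)"
    using int by (simp add: \<Psi>(2) has_bochner_integral_iff)
  thus ?thesis by (simp add: mu_pot_def c_def)
qed

subsection \<open>Integration by parts and the Newtonian potential of a Laplacian\<close>

lemma iter_dirderiv_append: "iter_dirderiv (iter_dirderiv f ws) vs = iter_dirderiv f (vs @ ws)"
  by (induction vs) auto

lemma test_function_has_derivative:
  assumes "test_function f"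
  shows "(f has_derivative (\<lambda>v. dirderiv f v x)) (at x)"
proof -
  have "f differentiable at x"
    using assms unfolding test_function_def smooth_def by (metis iter_dirderiv.simps(1))
  thus ?thesis unfolding dirderiv_def by (simp add: frechet_derivative_works)
qed

lemma has_derivative_zero_outside:
  assumes "(f has_derivative f') (at x)" "closed K" "x \<notin> K" "\<And>y. y \<notin> K \<Longrightarrow> f y = 0"
  shows "f' = (\<lambda>_. 0)"
proof (rule has_derivative_unique[OF assms(1)])
  show "(f has_derivative (\<lambda>_. 0)) (at x)"
    by (rule has_derivative_transform_within_open[of "\<lambda>_. 0" _ _ _ "- K"])
      (use assms in \<open>auto simp: open_Compl\<close>)
qed

lemma test_function_support:
  assumes "test_function f"
  obtains K where "compact K" "\<And>x. x \<notin> K \<Longrightarrow> f x = 0"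
proof
  show "compact (closure {x. f x \<noteq> 0})" using assms by (simp add: test_function_def)
  show "f x = 0" if "x \<notin> closure {x. f x \<noteq> 0}" for x
    using that closure_subset[of "{x. f x \<noteq> 0}"] by auto
qed

lemma test_function_dirderiv:
  assumes "test_function f"
  shows "test_function (dirderiv f v)"
  unfolding test_function_def
proof
  \<comment> \<open>The last entry of the list is differentiated first, so a derivative taken
    beforehand is appended at the end.\<close>
  have "iter_dirderiv (dirderiv f v) vs = iter_dirderiv f (vs @ [v])" for vs
    using iter_dirderiv_append[of f "[v]" vs] by simp
  thus "smooth (dirderiv f v)"
    using assms by (simp add: test_function_def smooth_def)
  obtain K where K: "compact K" "\<And>x. x \<notin> K \<Longrightarrow> f x = 0" using test_function_support[OF assms] by blast
  have "dirderiv f v x = 0" if "x \<notin> K" for x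
    using has_derivative_zero_outside[OF test_function_has_derivative[OF assms, of x] compact_imp_closed[OF K(1)] that K(2)]
    by metis
  hence "{x. dirderiv f v x \<noteq> 0} \<subseteq> K" by auto
  hence "closure {x. dirderiv f v x \<noteq> 0} \<subseteq> K"
    using K(1) by (simp add: closure_minimal compact_imp_closed)
  thus "compact (closure {x. dirderiv f v x \<noteq> 0})"
    using compact_Int_closed[OF K(1) closed_closure] by (metis Int_absorb1)
qed

lemma test_function_continuous_on: "test_function f \<Longrightarrow> continuous_on A f"
  by (meson continuous_at_imp_continuous_on has_derivative_continuous test_function_has_derivative)

lemma test_function_measurable: "test_function f \<Longrightarrow> f \<in> borel_measurable borel"
  by (rule borel_measurable_continuous_onI) (rule test_function_continuous_on)

lemma continuous_compact_support_bounded: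
  fixes f :: "'a::topological_space \<Rightarrow> real"
  assumes "continuous_on UNIV f" "compact K" "\<And>x. x \<notin> K \<Longrightarrow> f x = 0"
  obtains B where "B \<ge> 0" "\<And>x. \<bar>f x\<bar> \<le> B"
proof -
  have "bounded (f ` K)"
    using assms by (intro compact_imp_bounded compact_continuous_image) (auto intro: continuous_on_subset)
  then obtain B where B: "\<And>x. x \<in> K \<Longrightarrow> \<bar>f x\<bar> \<le> B" by (auto simp: bounded_iff)
  show ?thesis
    by (rule that[of "max 0 B"]) (use B assms(3) in \<open>force simp: le_max_iff_disj\<close>)+
qed

lemma test_function_bounded:
  assumes "test_function f"
  obtains B where "B \<ge> 0" "\<And>x. \<bar>f x\<bar> \<le> B"
  using continuous_compact_support_bounded test_function_continuous_on[OF assms] test_function_support[OF assms]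
  by metis

lemma continuous_compact_support_integrable:
  fixes f :: "'a::euclidean_space \<Rightarrow> real"
  assumes "continuous_on UNIV f" "compact K" "\<And>x. x \<notin> K \<Longrightarrow> f x = 0"
  shows "integrable lborel f"
proof -
  have "integrable lborel (\<lambda>x. indicator K x *\<^sub>R f x)"
    using assms by (intro borel_integrable_compact) (auto intro: continuous_on_subset)
  also have "(\<lambda>x. indicator K x *\<^sub>R f x) = f"
    using assms(3) by (auto simp: indicator_def fun_eq_iff)
  finally show ?thesis .
qed

lemma test_function_integrable: "test_function f \<Longrightarrow> integrable lborel f"
  using continuous_compact_support_integrable test_function_continuous_on test_function_support by metis

lemma mu_continuous: "continuous_on A mu"
  unfolding mu_def
proof (intro continuous_intros)
  show "\<forall>x\<in>A. pi * (1 + (norm x)\<^sup>2)\<^sup>2 \<noteq> 0"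
  proof
    fix x
    have "1 + (norm x)\<^sup>2 \<noteq> 0" using one_plus_norm_sq_pos[of x] by linarith
    thus "pi * (1 + (norm x)\<^sup>2)\<^sup>2 \<noteq> 0" by simp
  qed
qed

text \<open>The quotient \<open>f x / mu x\<close> is continuous with compact support, hence
  bounded.\<close>

lemma test_function_mu_bounded:
  assumes "test_function f"
  shows "mu_bounded f"
proof -
  obtain K where K: "compact K" "\<And>x. x \<notin> K \<Longrightarrow> f x = 0" using test_function_support[OF assms] by blast
  have "continuous_on UNIV (\<lambda>x. f x / mu x)"
    using mu_pos by (intro continuous_on_divide test_function_continuous_on assms mu_continuous)
      (auto simp: less_imp_neq[THEN not_sym])
  then obtain B where B: "\<And>x. \<bar>f x / mu x\<bar> \<le> B"
    by (rule continuous_compact_support_bounded[of "\<lambda>x. f x / mu x" K]) (use K in auto)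
  have "\<bar>f x\<bar> \<le> B * mu x" for x
    using B[of x] mu_pos[of x] by (simp add: abs_mult field_simps)
  thus ?thesis using test_function_measurable[OF assms] by (intro mu_boundedI)
qed

lemma has_real_derivative_line:
  assumes "\<And>x. (F has_derivative F' x) (at x)"
  shows "((\<lambda>t. F (x + t *\<^sub>R e)) has_real_derivative F' (x + t *\<^sub>R e) e) (at t)"
proof -
  have "((\<lambda>t. F (x + t *\<^sub>R e)) has_derivative (\<lambda>s. F' (x + t *\<^sub>R e) (s *\<^sub>R e))) (at t)"
    by (rule has_derivative_compose[of "\<lambda>t. x + t *\<^sub>R e" _ t UNIV F, OF _ assms])
      (auto intro!: derivative_eq_intros)
  moreover have "F' (x + t *\<^sub>R e) (s *\<^sub>R e) = F' (x + t *\<^sub>R e) e * s" for s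
    using linear_scale[OF has_derivative_linear[OF assms]] by simp
  ultimately show ?thesis by (simp add: has_field_derivative_def)
qed

text \<open>The integral of the difference quotient vanishes by translation invariance.\<close>
lemma integral_directional_derivative_zero:
  fixes F :: "'a::euclidean_space \<Rightarrow> real"
  assumes F: "\<And>x. (F has_derivative F' x) (at x)" and cont: "continuous_on UNIV (\<lambda>x. F' x e)"
    and K: "compact K" "\<And>x. x \<notin> K \<Longrightarrow> F x = 0"
  shows "(\<integral>x. F' x e \<partial>lborel) = 0"
proof -
  have contF: "continuous_on UNIV F"
    using F by (meson continuous_at_imp_continuous_on has_derivative_continuous)
  have F_int: "integrable lborel F" by (rule continuous_compact_support_integrable[OF contF K])
  have [measurable]: "F \<in> borel_measurable borel" "(\<lambda>x. F' x e) \<in> borel_measurable borel"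
    using contF cont by (auto intro: borel_measurable_continuous_onI)
  have zero: "F' x e = 0" if "x \<notin> K" for x
    using has_derivative_zero_outside[OF F compact_imp_closed[OF K(1)] that K(2)] by simp
  obtain B where B: "\<And>x. \<bar>F' x e\<bar> \<le> B"
    using continuous_compact_support_bounded[OF cont K(1) zero] by blast
  obtain R where "\<forall>x\<in>K. norm x \<le> R"
    using compact_imp_bounded[OF K(1)] by (auto simp: bounded_iff)
  hence R: "K \<subseteq> cball 0 R" by auto
  define h where "h n = 1 / real (Suc n)" for n
  have h: "0 < h n" "h n \<le> 1" for n by (auto simp: h_def)
  define s where "s n x = (F (h n *\<^sub>R e + x) - F x) / h n" for n x
  have "(\<lambda>n. \<integral>x. s n x \<partial>lborel) \<longlonglongrightarrow> (\<integral>x. F' x e \<partial>lborel)"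
  proof (rule integral_dominated_convergence)
    \<comment> \<open>Steps of size at most 1 shift the support by at most \<open>norm e\<close>, so
      all difference quotients live in one ball; the mean value theorem bounds them there by
      \<open>B\<close>.\<close>
    show "integrable lborel (\<lambda>x. B * indicator (cball 0 (R + norm e)) x)"
      using emeasure_lborel_cball_finite by (intro integrable_mult_right integrable_real_indicator) auto
    show "s n \<in> borel_measurable lborel" for n unfolding s_def by measurable
    show "AE x in lborel. (\<lambda>n. s n x) \<longlonglongrightarrow> F' x e"
    proof (rule AE_I2)
      fix x
      have "((\<lambda>t. (F (x + (0 + t) *\<^sub>R e) - F (x + 0 *\<^sub>R e)) / t) \<longlongrightarrow> F' (x + 0 *\<^sub>R e) e) (at 0)"
        using has_real_derivative_line[OF F, of x e 0] by (simp only: DERIV_def)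
      moreover have "filterlim h (at 0) sequentially"
        using LIMSEQ_inverse_real_of_nat
        by (auto simp: filterlim_at h_def[abs_def] inverse_eq_divide)
      ultimately have "((\<lambda>n. (F (x + (0 + h n) *\<^sub>R e) - F (x + 0 *\<^sub>R e)) / h n) \<longlongrightarrow> F' (x + 0 *\<^sub>R e) e) sequentially"
        by (rule filterlim_compose)
      thus "(\<lambda>n. s n x) \<longlonglongrightarrow> F' x e" by (simp add: s_def add.commute)
    qed
    show "AE x in lborel. norm (s n x) \<le> B * indicator (cball 0 (R + norm e)) x" for n
    proof (rule AE_I2)
      fix x
      show "norm (s n x) \<le> B * indicator (cball 0 (R + norm e)) x"
      proof (cases "x \<in> cball 0 (R + norm e)")
        case True
        have "\<exists>z>0. z < h n \<and> F (x + h n *\<^sub>R e) - F (x + 0 *\<^sub>R e) = (h n - 0) * F' (x + z *\<^sub>R e) e"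
          using h(1)[of n] by (intro MVT2 has_real_derivative_line F)
        then obtain z where "F (x + h n *\<^sub>R e) - F x = h n * F' (x + z *\<^sub>R e) e" by auto
        hence "s n x = F' (x + z *\<^sub>R e) e" using h(1)[of n] by (simp add: s_def add.commute)
        thus ?thesis using B True by simp
      next
        case False
        have "norm (h n *\<^sub>R e) \<le> norm e" using h[of n] by (simp add: mult_left_le_one_le)
        moreover have "norm x \<le> norm (h n *\<^sub>R e + x) + norm (h n *\<^sub>R e)"
          using norm_triangle_ineq4[of "h n *\<^sub>R e + x" "h n *\<^sub>R e"] by simp
        moreover have "R + norm e < norm x" using False by simp
        ultimately have "R < norm x" "R < norm (h n *\<^sub>R e + x)" using norm_ge_zero[of e] by linarith+
        hence "x \<notin> K" "h n *\<^sub>R e + x \<notin> K" using R by auto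
        hence "s n x = 0" by (simp add: s_def K(2))
        thus ?thesis using False by simp
      qed
    qed
  qed simp
  moreover have "(\<integral>x. s n x \<partial>lborel) = 0" for n
    unfolding s_def using F_int integrable_translate[of F "h n *\<^sub>R e"] integral_translate[of F "h n *\<^sub>R e"] by simp
  ultimately show ?thesis by (simp add: LIMSEQ_const_iff)
qed

section \<open>The Laplacian of a test function: mean and Dirichlet energy\<close>

definition laplacian :: "('a::euclidean_space \<Rightarrow> real) \<Rightarrow> 'a \<Rightarrow> real" where
  "laplacian f x = (\<Sum>i\<in>Basis. dirderiv (dirderiv f i) i x)"

lemma mu_bounded_sum: "finite I \<Longrightarrow> (\<And>i. i \<in> I \<Longrightarrow> mu_bounded (u i)) \<Longrightarrow> mu_bounded (\<lambda>x. \<Sum>i\<in>I. u i x)"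
  by (induction I rule: finite_induct) (auto intro!: mu_bounded_add mu_boundedI[of "\<lambda>_. 0" 0])

lemma mu_bounded_laplacian: "test_function f \<Longrightarrow> mu_bounded (laplacian f)"
  unfolding laplacian_def[abs_def]
  by (intro mu_bounded_sum test_function_mu_bounded test_function_dirderiv) auto

lemma integral_dirderiv_zero:
  assumes "test_function f"
  shows "(\<integral>x. dirderiv f i x \<partial>lborel) = 0"
proof -
  obtain K where "compact K" "\<And>x. x \<notin> K \<Longrightarrow> f x = 0" using test_function_support[OF assms] by blast
  thus ?thesis
    by (intro integral_directional_derivative_zero[OF test_function_has_derivative[OF assms]]
        test_function_continuous_on test_function_dirderiv assms)
qed

lemma integral_laplacian_zero:
  assumes "test_function f"
  shows "(\<integral>x. laplacian f x \<partial>lborel) = 0"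
  unfolding laplacian_def using assms
  by (subst Bochner_Integration.integral_sum)
    (auto simp: integral_dirderiv_zero test_function_dirderiv intro!: test_function_integrable)

text \<open>For each basis direction the product \<open>f * dirderiv f i\<close> has compact
  support, so the integral of its derivative vanishes. Applied to the energy of
  \<open>laplacian f\<close>, this is the source of the gradient term.\<close>

lemma integral_mult_laplacian:
  assumes f: "test_function f"
  shows "(\<integral>x. f x * laplacian f x \<partial>lborel) = - (\<integral>x. grad_norm_sq f x \<partial>lborel)"
proof -
  obtain K where K: "compact K" "\<And>x. x \<notin> K \<Longrightarrow> f x = 0" using test_function_support[OF f] by blast
  note tf = f test_function_dirderiv[OF f] test_function_dirderiv[OF test_function_dirderiv[OF f]]
  note cont = tf[THEN test_function_continuous_on]
  have int1: "integrable lborel (\<lambda>x. f x * dirderiv (dirderiv f i) i x)" for i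
    using K by (intro continuous_compact_support_integrable[of _ K] continuous_intros cont) auto
  have int2: "integrable lborel (\<lambda>x. (dirderiv f i x)\<^sup>2)" for i
  proof -
    obtain L where "compact L" "\<And>x. x \<notin> L \<Longrightarrow> dirderiv f i x = 0"
      using test_function_support[OF tf(2)] by blast
    thus ?thesis
      by (intro continuous_compact_support_integrable[of _ L] continuous_intros cont) auto
  qed
  have zero: "(\<integral>x. f x * dirderiv (dirderiv f i) i x + (dirderiv f i x)\<^sup>2 \<partial>lborel) = 0" for i
  proof -
    have "(\<integral>x. f x * dirderiv (dirderiv f i) i x + dirderiv f i x * dirderiv f i x \<partial>lborel) = 0"
      using K by (intro integral_directional_derivative_zero[of "\<lambda>x. f x * dirderiv f i x"
          "\<lambda>x v. f x * dirderiv (dirderiv f i) v x + dirderiv f v x * dirderiv f i x" i K]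
          has_derivative_mult tf[THEN test_function_has_derivative] continuous_intros cont) auto
    thus ?thesis by (simp add: power2_eq_square)
  qed
  have "(\<integral>x. f x * dirderiv (dirderiv f i) i x \<partial>lborel) = - (\<integral>x. (dirderiv f i x)\<^sup>2 \<partial>lborel)" for i
    using zero[of i] Bochner_Integration.integral_add[OF int1[of i] int2[of i]] by linarith
  thus ?thesis
    unfolding laplacian_def grad_norm_sq_def[abs_def] sum_distrib_left
    using int1 int2 by (simp add: Bochner_Integration.integral_sum sum_negf)
qed

section \<open>The regularized logarithm and the potential of a Laplacian\<close>

lemma integral_lborel_affine:
  fixes f :: "'a::euclidean_space \<Rightarrow> real"
  assumes [measurable]: "f \<in> borel_measurable borel" and "c \<noteq> 0"
  shows "(\<integral>x. f x \<partial>lborel) = \<bar>c\<bar> ^ DIM('a) * (\<integral>x. f (t + c *\<^sub>R x) \<partial>lborel)"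
proof -
  have "(\<integral>x. f x \<partial>lborel)
      = (\<integral>x. f x \<partial>density (distr lborel borel (\<lambda>x. t + c *\<^sub>R x)) (\<lambda>_. ennreal (\<bar>c\<bar> ^ DIM('a))))"
    using lborel_affine[OF assms(2), of t] by simp
  also have "\<dots> = \<bar>c\<bar> ^ DIM('a) * (\<integral>x. f (t + c *\<^sub>R x) \<partial>lborel)"
    by (subst integral_density) (auto simp: integral_distr)
  finally show ?thesis .
qed

text \<open>The smooth function ln(|y - x|^2 + \<delta>^2)/2 has Laplacian 2 \<delta>^2/(|y - x|^2 +
  \<delta>^2)^2, which is 2 pi times \<open>mu\<close> rescaled to width \<delta> around
  \<open>x\<close>. Moving both derivatives onto it makes \<open>mu\<close> itself the approximate
  identity.\<close>

lemma regularized_log_laplacian: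
  fixes f :: "real^2 \<Rightarrow> real"
  assumes f: "test_function f" and "\<delta> > 0"
  shows "(\<integral>y. laplacian f y * (ln ((norm (y - x))\<^sup>2 + \<delta>\<^sup>2) / 2) \<partial>lborel)
       = 2 * pi * (\<integral>z. mu z * f (x + \<delta> *\<^sub>R z) \<partial>lborel)"
proof -
  obtain K where K: "compact K" "\<And>x. x \<notin> K \<Longrightarrow> f x = 0" using test_function_support[OF f] by blast
  note tf = f test_function_dirderiv[OF f] test_function_dirderiv[OF test_function_dirderiv[OF f]]
  note cont = tf[THEN test_function_continuous_on]
  have [measurable]: "f \<in> borel_measurable borel" by (rule test_function_measurable[OF f])
  define q where "q y = (norm (y - x))\<^sup>2 + \<delta>\<^sup>2" for y
  define B where "B y = ln (q y) / 2" for y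
  \<comment> \<open>\<open>B1 y\<close> is the derivative of the regularized logarithm
    \<open>B\<close>, and \<open>B2 i y\<close> that of its i-th partial derivative.\<close>
  define B1 where "B1 y v = ((y - x) \<bullet> v) / q y" for y v
  define B2 where "B2 i y v = ((v \<bullet> i) * q y - ((y - x) \<bullet> i) * (2 * ((y - x) \<bullet> v))) / (q y * q y)" for i y v
  have q: "q y > 0" for y using \<open>\<delta> > 0\<close> by (simp add: q_def add_nonneg_pos)
  have q_cont: "continuous_on UNIV q" unfolding q_def by (intro continuous_intros)
  have q_deriv: "(q has_derivative (\<lambda>v. 2 * ((y - x) \<bullet> v))) (at y)" for y
    unfolding q_def[abs_def] power2_norm_eq_inner
    by (auto intro!: derivative_eq_intros simp: inner_commute)
  have B: "(B has_derivative B1 y) (at y)" for y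
    unfolding B_def[abs_def] B1_def[abs_def]
    by (auto intro!: derivative_eq_intros q_deriv simp: q field_simps)
  have B1: "((\<lambda>y. B1 y i) has_derivative B2 i y) (at y)" for y i
    unfolding B1_def[abs_def] B2_def[abs_def]
    by (auto intro!: derivative_eq_intros q_deriv simp: q less_imp_neq[OF q, THEN not_sym])
  have B_cont: "continuous_on UNIV B"
    using q by (auto simp: B_def[abs_def] intro!: continuous_intros q_cont simp: less_imp_neq[THEN not_sym])
  have B2_cont: "continuous_on UNIV (\<lambda>y. B2 i y i)" for i
    using q by (auto simp: B2_def[abs_def] intro!: continuous_intros q_cont simp: less_imp_neq[THEN not_sym])
  have int2: "integrable lborel (\<lambda>y. f y * B2 i y i)" for i
    using K by (intro continuous_compact_support_integrable[of _ K] continuous_intros cont B2_cont) auto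
  have int1: "integrable lborel (\<lambda>y. dirderiv (dirderiv f i) i y * B y)" for i
  proof -
    obtain L where "compact L" "\<And>x. x \<notin> L \<Longrightarrow> dirderiv (dirderiv f i) i x = 0"
      using test_function_support[OF tf(3)] by blast
    thus ?thesis
      by (intro continuous_compact_support_integrable[of _ L] continuous_intros cont B_cont) auto
  qed
  have i: "(\<integral>y. dirderiv (dirderiv f i) i y * B y \<partial>lborel) = (\<integral>y. f y * B2 i y i \<partial>lborel)" for i
  proof -
    \<comment> \<open>Green's identity in one direction: the derivative of this combination is the
      difference of the two integrands, because the mixed first-order products cancel.\<close>
    define F where "F y = dirderiv f i y * B y - f y * B1 y i" for y
    define F' where "F' y v = (dirderiv f i y * B1 y v + dirderiv (dirderiv f i) v y * B y)
        - (f y * B2 i y v + dirderiv f v y * B1 y i)" for y v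
    have eq: "F' y i = dirderiv (dirderiv f i) i y * B y - f y * B2 i y i" for y
      by (simp add: F'_def)
    have F: "(F has_derivative F' y) (at y)" for y
      unfolding F_def F'_def
      by (intro has_derivative_diff has_derivative_mult tf[THEN test_function_has_derivative] B B1)
    obtain L where L: "compact L" "\<And>x. x \<notin> L \<Longrightarrow> dirderiv f i x = 0"
      using test_function_support[OF tf(2)] by blast
    have "(\<integral>y. F' y i \<partial>lborel) = 0"
    proof (rule integral_directional_derivative_zero[OF F])
      show "compact (K \<union> L)" using K L by auto
      show "F y = 0" if "y \<notin> K \<union> L" for y using that K L by (simp add: F_def)
      show "continuous_on UNIV (\<lambda>y. F' y i)"
        unfolding eq by (intro continuous_intros cont B_cont B2_cont)
    qed
    thus ?thesis unfolding eq using int1 int2 by simp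
  qed
  \<comment> \<open>The plane has two basis vectors, so the sum yields 2q - 2|y - x|^2 and only 2
    \<delta>^2 survives.\<close>
  have sum_B2: "(\<Sum>i\<in>Basis. B2 i y i) = 2 * \<delta>\<^sup>2 / (q y)\<^sup>2" for y
  proof -
    have "(\<Sum>i\<in>Basis. ((y - x) \<bullet> i) * ((y - x) \<bullet> i)) = (norm (y - x))\<^sup>2"
      by (simp add: euclidean_inner[symmetric] power2_norm_eq_inner)
    hence "(\<Sum>i\<in>Basis. (q y - ((y - x) \<bullet> i) * (2 * ((y - x) \<bullet> i)))) = 2 * q y - 2 * (norm (y - x))\<^sup>2"
      by (simp add: sum_subtractf sum_distrib_left[symmetric] mult.left_commute[of _ 2])
    also have "\<dots> = 2 * \<delta>\<^sup>2" by (simp add: q_def)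
    finally have s: "(\<Sum>i\<in>Basis. (q y - ((y - x) \<bullet> i) * (2 * ((y - x) \<bullet> i)))) = 2 * \<delta>\<^sup>2" .
    have "(\<Sum>i\<in>Basis. B2 i y i) = (\<Sum>i\<in>Basis. (q y - ((y - x) \<bullet> i) * (2 * ((y - x) \<bullet> i)))) / (q y)\<^sup>2"
      unfolding sum_divide_distrib
      by (intro sum.cong) (auto simp: B2_def inner_Basis power2_eq_square)
    thus ?thesis unfolding s .
  qed
  have "(\<integral>y. laplacian f y * B y \<partial>lborel) = (\<Sum>i\<in>Basis. \<integral>y. dirderiv (dirderiv f i) i y * B y \<partial>lborel)"
    unfolding laplacian_def sum_distrib_right using int1 by (simp add: Bochner_Integration.integral_sum)
  also have "\<dots> = (\<integral>y. f y * (\<Sum>i\<in>Basis. B2 i y i) \<partial>lborel)"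
    unfolding i sum_distrib_left using int2 by (simp add: Bochner_Integration.integral_sum)
  also have "\<dots> = (\<integral>y. f y * (2 * \<delta>\<^sup>2 / (q y)\<^sup>2) \<partial>lborel)" unfolding sum_B2 ..
  \<comment> \<open>Substitution y = x + \<delta> z. The Jacobian \<delta>^2 and the numerator 2
    \<delta>^2 cancel the \<delta>^4 in the denominator.\<close>
  also have "\<dots> = \<bar>\<delta>\<bar> ^ DIM(real^2) * (\<integral>z. f (x + \<delta> *\<^sub>R z) * (2 * \<delta>\<^sup>2 / (q (x + \<delta> *\<^sub>R z))\<^sup>2) \<partial>lborel)"
    using \<open>\<delta> > 0\<close> by (intro integral_lborel_affine) (auto simp: q_def)
  also have "\<dots> = (\<integral>z. 2 * pi * (mu z * f (x + \<delta> *\<^sub>R z)) \<partial>lborel)"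
    unfolding integral_mult_right_zero[symmetric]
  proof (rule Bochner_Integration.integral_cong[OF refl])
    fix z :: "real^2"
    have "q (x + \<delta> *\<^sub>R z) = \<delta>\<^sup>2 * (1 + (norm z)\<^sup>2)"
      by (simp add: q_def power_mult_distrib algebra_simps)
    thus "\<bar>\<delta>\<bar> ^ DIM(real^2) * (f (x + \<delta> *\<^sub>R z) * (2 * \<delta>\<^sup>2 / (q (x + \<delta> *\<^sub>R z))\<^sup>2))
        = 2 * pi * (mu z * f (x + \<delta> *\<^sub>R z))"
      using \<open>\<delta> > 0\<close> by (simp add: mu_def power_mult_distrib power4_eq_xxxx power2_eq_square[of \<delta>])
  qed
  also have "\<dots> = 2 * pi * (\<integral>z. mu z * f (x + \<delta> *\<^sub>R z) \<partial>lborel)" by simp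
  finally show ?thesis by (simp add: B_def q_def)
qed

text \<open>A bound uniform in \<delta>, needed for dominated convergence. If the argument is at
  least 1, its logarithm lies between 0 and ln(1 + r^2); otherwise it lies between 2 ln r and
  0.\<close>

lemma abs_ln_regularized_le:
  fixes r \<delta> :: real
  assumes "r > 0" "0 < \<delta>" "\<delta> \<le> 1"
  shows "\<bar>ln (r\<^sup>2 + \<delta>\<^sup>2) / 2\<bar> \<le> \<bar>ln r\<bar> + ln (1 + r\<^sup>2) / 2"
proof (cases "r\<^sup>2 + \<delta>\<^sup>2 \<ge> 1")
  case True
  have "\<delta>\<^sup>2 \<le> 1" using assms power_le_one[of \<delta> 2] by simp
  hence "ln (r\<^sup>2 + \<delta>\<^sup>2) \<le> ln (1 + r\<^sup>2)" using assms by (intro ln_mono) (auto simp: add_pos_pos)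
  thus ?thesis using True by simp
next
  case False
  have "ln (r\<^sup>2) \<le> ln (r\<^sup>2 + \<delta>\<^sup>2)" using assms by (intro ln_mono) auto
  hence "2 * ln r \<le> ln (r\<^sup>2 + \<delta>\<^sup>2)" using assms by (simp add: ln_realpow)
  moreover have "ln (r\<^sup>2 + \<delta>\<^sup>2) \<le> 0" using False assms by (simp add: add_pos_pos)
  moreover have "0 \<le> ln (1 + r\<^sup>2)" by simp
  ultimately show ?thesis by linarith
qed

text \<open>Let the regularization tend to 0. On one side the kernel converges to the logarithm off
  the diagonal; on the other the rescaled \<open>mu\<close>, of mass 1, concentrates at
  \<open>x\<close>.\<close>

lemma potential_laplacian:
  fixes f :: "real^2 \<Rightarrow> real"
  assumes f: "test_function f"
  shows "(\<integral>y. laplacian f y * ln (dist x y) \<partial>lborel) = 2 * pi * f x"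
proof -
  have [measurable]: "f \<in> borel_measurable borel" "laplacian f \<in> borel_measurable borel"
    using test_function_measurable[OF f] mu_bounded_measurable[OF mu_bounded_laplacian[OF f]] by auto
  note lap = mu_bounded_laplacian[OF f]
  define h where "h n = 1 / real (Suc n)" for n
  have h: "0 < h n" "h n \<le> 1" for n by (auto simp: h_def)
  have h0: "h \<longlonglongrightarrow> 0"
    using LIMSEQ_inverse_real_of_nat by (simp add: h_def[abs_def] inverse_eq_divide)
  have lim: "(\<lambda>n. \<integral>y. laplacian f y * (ln ((norm (y - x))\<^sup>2 + (h n)\<^sup>2) / 2) \<partial>lborel)
      \<longlonglongrightarrow> (\<integral>y. laplacian f y * ln (dist x y) \<partial>lborel)"
  proof (rule integral_dominated_convergence)
    \<comment> \<open>Independent of \<open>n\<close>: the first term bounds the singular part, the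
      other two the growth ln(1 + |x - y|^2)/2 after it is split between \<open>x\<close> and
      \<open>y\<close>.\<close>
    let ?m = "\<lambda>y. \<bar>laplacian f y * ln (dist x y)\<bar> + \<bar>laplacian f y * mu_pot y\<bar> + \<bar>laplacian f y * (mu_pot x + ln 2 / 2)\<bar>"
    show "integrable lborel ?m"
      using lap by (intro Bochner_Integration.integrable_add integrable_abs mu_bounded_integrable_ln_dist
          mu_bounded_integrable_mu_pot integrable_mult_left mu_bounded_integrable)
    have ae: "AE y in lborel. y \<noteq> x" by (rule AE_lborel_singleton)
    show "AE y in lborel. (\<lambda>n. laplacian f y * (ln ((norm (y - x))\<^sup>2 + (h n)\<^sup>2) / 2))
        \<longlonglongrightarrow> laplacian f y * ln (dist x y)"
      using ae
    proof eventually_elim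
      case (elim y)
      have "(\<lambda>n. laplacian f y * (ln ((norm (y - x))\<^sup>2 + (h n)\<^sup>2) / 2))
          \<longlonglongrightarrow> laplacian f y * (ln ((norm (y - x))\<^sup>2 + 0\<^sup>2) / 2)"
        using elim by (intro tendsto_intros h0) auto
      also have "ln ((norm (y - x))\<^sup>2 + 0\<^sup>2) / 2 = ln (dist x y)"
        using elim by (simp add: ln_realpow dist_norm norm_minus_commute)
      finally show ?case .
    qed
    show "AE y in lborel. norm (laplacian f y * (ln ((norm (y - x))\<^sup>2 + (h n)\<^sup>2) / 2)) \<le> ?m y" for n
      using ae
    proof eventually_elim
      case (elim y)
      have "\<bar>ln ((dist x y)\<^sup>2 + (h n)\<^sup>2) / 2\<bar> \<le> \<bar>ln (dist x y)\<bar> + ln (1 + (dist x y)\<^sup>2) / 2"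
        using elim by (intro abs_ln_regularized_le h) auto
      also have "\<dots> \<le> \<bar>ln (dist x y)\<bar> + (mu_pot y + (mu_pot x + ln 2 / 2))"
        using ln_one_plus_dist_sq_le[of x y] by simp
      finally have "\<bar>laplacian f y\<bar> * \<bar>ln ((dist x y)\<^sup>2 + (h n)\<^sup>2) / 2\<bar>
          \<le> \<bar>laplacian f y\<bar> * (\<bar>ln (dist x y)\<bar> + (mu_pot y + (mu_pot x + ln 2 / 2)))"
        by (intro mult_left_mono) auto
      also have "\<dots> = ?m y"
        using mu_pot_nonneg[of x] mu_pot_nonneg[of y] unfolding abs_mult by (simp add: distrib_left)
      finally show ?case by (simp add: abs_mult dist_norm norm_minus_commute)
    qed
  qed simp_all
  obtain C where C: "\<And>x. \<bar>f x\<bar> \<le> C" using test_function_bounded[OF f] by blast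
  have "(\<lambda>n. 2 * pi * (\<integral>z. mu z * f (x + h n *\<^sub>R z) \<partial>lborel)) \<longlonglongrightarrow> 2 * pi * (\<integral>z. mu z * f x \<partial>lborel)"
  proof (intro tendsto_mult_left integral_dominated_convergence)
    show "integrable lborel (\<lambda>z. mu z * C)"
      using mu_bounded_integrable[OF mu_bounded_mu] by simp
    show "AE z in lborel. norm (mu z * f (x + h n *\<^sub>R z)) \<le> mu z * C" for n
      using C less_imp_le[OF mu_pos] by (intro AE_I2) (simp add: abs_mult mult_left_mono)
    show "AE z in lborel. (\<lambda>n. mu z * f (x + h n *\<^sub>R z)) \<longlonglongrightarrow> mu z * f x"
    proof (rule AE_I2)
      fix z
      have "(\<lambda>n. x + h n *\<^sub>R z) \<longlonglongrightarrow> x + 0 *\<^sub>R z" by (intro tendsto_intros h0)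
      hence "(\<lambda>n. x + h n *\<^sub>R z) \<longlonglongrightarrow> x" by simp
      hence "(\<lambda>n. f (x + h n *\<^sub>R z)) \<longlonglongrightarrow> f x"
        by (rule continuous_on_tendsto_compose[OF test_function_continuous_on[OF f, of UNIV]]) auto
      thus "(\<lambda>n. mu z * f (x + h n *\<^sub>R z)) \<longlonglongrightarrow> mu z * f x" by (intro tendsto_intros)
    qed
  qed simp_all
  with lim have "(\<integral>y. laplacian f y * ln (dist x y) \<partial>lborel) = 2 * pi * (\<integral>z. mu z * f x \<partial>lborel)"
    unfolding regularized_log_laplacian[OF f h(1)] by (rule LIMSEQ_unique)
  thus ?thesis using has_bochner_integral_mu by (simp add: has_bochner_integral_iff)
qed

subsection \<open>The inequality\<close>

definition log_energy :: "(real^2 \<Rightarrow> real) \<Rightarrow> (real^2 \<Rightarrow> real) \<Rightarrow> real" where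
  "log_energy u v = (\<integral>(x, y). u x * v y * ln (dist x y) \<partial>(lborel \<Otimes>\<^sub>M lborel))"

lemma log_energy_potential:
  assumes "mu_bounded u" "mu_bounded v"
  shows "log_energy u v = (\<integral>x. u x * (\<integral>y. v y * ln (dist x y) \<partial>lborel) \<partial>lborel)"
  using lborel_pair.integral_fst[OF mu_bounded_integrable_pair[OF assms]]
  by (simp add: log_energy_def mult.assoc)

text \<open>Explicit potentials are available for \<open>mu\<close> and \<open>laplacian f\<close>
  in the right argument only; symmetry gives access to them in the left one.\<close>

lemma log_energy_commute:
  assumes "mu_bounded u" "mu_bounded v"
  shows "log_energy u v = log_energy v u"
proof -
  have "log_energy v u = (\<integral>y. (\<integral>x. u x * v y * ln (dist x y) \<partial>lborel) \<partial>lborel)"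
    unfolding log_energy_potential[OF assms(2,1)] integral_mult_right_zero[symmetric]
    by (intro Bochner_Integration.integral_cong refl) (simp add: dist_commute)
  also have "\<dots> = log_energy u v"
    unfolding log_energy_def by (rule lborel_pair.integral_snd[OF mu_bounded_integrable_pair[OF assms]])
  finally show ?thesis ..
qed

lemma log_energy_add_right:
  assumes "mu_bounded u" "mu_bounded v" "mu_bounded v'"
  shows "log_energy u (\<lambda>x. v x + v' x) = log_energy u v + log_energy u v'"
proof -
  have "log_energy u (\<lambda>x. v x + v' x)
      = (\<integral>p. (case p of (x, y) \<Rightarrow> u x * v y * ln (dist x y))
           + (case p of (x, y) \<Rightarrow> u x * v' y * ln (dist x y)) \<partial>(lborel \<Otimes>\<^sub>M lborel))"
    unfolding log_energy_def by (intro Bochner_Integration.integral_cong) (auto simp: algebra_simps)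
  thus ?thesis
    using mu_bounded_integrable_pair[OF assms(1,2)] mu_bounded_integrable_pair[OF assms(1,3)]
    by (simp add: log_energy_def)
qed

lemma log_energy_cmult_right: "log_energy u (\<lambda>x. c * v x) = c * log_energy u v"
proof -
  have "log_energy u (\<lambda>x. c * v x)
      = (\<integral>p. c * (case p of (x, y) \<Rightarrow> u x * v y * ln (dist x y)) \<partial>(lborel \<Otimes>\<^sub>M lborel))"
    unfolding log_energy_def by (intro Bochner_Integration.integral_cong) (auto simp: mult_ac)
  thus ?thesis by (simp add: log_energy_def)
qed

lemma log_energy_mu: "mu_bounded u \<Longrightarrow> log_energy u mu = (\<integral>x. u x * mu_pot x \<partial>lborel)"
  by (simp add: log_energy_potential mu_bounded_mu potential_mu)

lemma log_energy_laplacian: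
  "mu_bounded u \<Longrightarrow> test_function f \<Longrightarrow> log_energy u (laplacian f) = 2 * pi * (\<integral>x. u x * f x \<partial>lborel)"
  by (simp add: log_energy_potential mu_bounded_laplacian potential_laplacian mult.left_commute[of _ "2 * pi"])

text \<open>Expansion by bilinearity. Only the self-energy of \<open>g\<close> stays unevaluated.
  The term \<open>b\<^sup>2 / 2\<close> comes from the energy 1/2 of \<open>mu\<close>, the factor 4
  pi from two cross terms of 2 pi each, and the gradient term from the self-energy of
  \<open>laplacian f\<close>.\<close>

lemma log_energy_combination:
  fixes a b :: real
  assumes g: "mu_bounded g" and f: "test_function f"
  defines "u \<equiv> \<lambda>x. g x + (b * mu x + a * laplacian f x)"
  shows "log_energy u u = log_energy g g + 2 * b * (\<integral>x. g x * mu_pot x \<partial>lborel) + b\<^sup>2 / 2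
      + 4 * pi * a * ((\<integral>x. g x * f x \<partial>lborel) + b * (\<integral>x. mu x * f x \<partial>lborel))
      - 2 * pi * a\<^sup>2 * (\<integral>x. grad_norm_sq f x \<partial>lborel)"
proof -
  note l = mu_bounded_laplacian[OF f]
  note [simp] = g l mu_bounded_mu mu_bounded_add mu_bounded_cmult
  have u [simp]: "mu_bounded u" by (simp add: u_def)
  have right: "log_energy v u = log_energy v g + b * log_energy v mu + a * log_energy v (laplacian f)"
    if "mu_bounded v" for v
    using that unfolding u_def by (simp add: log_energy_add_right log_energy_cmult_right)
  have gg: "log_energy u g = log_energy g g + b * (\<integral>x. g x * mu_pot x \<partial>lborel) + 2 * pi * a * (\<integral>x. g x * f x \<partial>lborel)"
    using log_energy_commute[OF u g] right[OF g] g f by (simp add: log_energy_mu log_energy_laplacian)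
  have mm: "log_energy u mu = (\<integral>x. g x * mu_pot x \<partial>lborel) + b / 2 + 2 * pi * a * (\<integral>x. mu x * f x \<partial>lborel)"
    using log_energy_commute[OF u mu_bounded_mu] right[OF mu_bounded_mu] log_energy_commute[OF mu_bounded_mu g]
      has_bochner_integral_mu_mu_pot f
    by (simp add: log_energy_mu log_energy_laplacian has_bochner_integral_iff)
  have ll: "log_energy u (laplacian f)
      = 2 * pi * (\<integral>x. g x * f x \<partial>lborel) + 2 * pi * b * (\<integral>x. mu x * f x \<partial>lborel) - 2 * pi * a * (\<integral>x. grad_norm_sq f x \<partial>lborel)"
    using log_energy_commute[OF u l] right[OF l] log_energy_commute[OF l g] log_energy_commute[OF l mu_bounded_mu]
      integral_mult_laplacian[OF f] f
    by (simp add: log_energy_laplacian mult.commute[of "laplacian f _"])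
  show ?thesis
    unfolding right[OF u] gg mm ll by (simp add: power2_eq_square algebra_simps)
qed

theorem theorem2:
  fixes f :: "real^2 \<Rightarrow> real"
  assumes "test_function f"
  defines "M \<equiv> integral\<^sup>L lborel (\<lambda>x. exp (f x) * mu x)"
      and "g \<equiv> (\<lambda>x. exp (f x) * mu x)"
  shows "integral\<^sup>L lborel (\<lambda>x. g x * ln (g x / M))
           - (4 * pi / M) * inv_lap_pairing g + M * (1 + ln pi)
         \<le> M * ((1 / (16 * pi)) * integral\<^sup>L lborel (grad_norm_sq f)
                + integral\<^sup>L lborel (\<lambda>x. f x * mu x) - ln M)"
proof -
  note f = assms(1)
  have [measurable]: "f \<in> borel_measurable borel" by (rule test_function_measurable[OF f])
  obtain C where C: "C \<ge> 0" "\<And>x. \<bar>f x\<bar> \<le> C" using test_function_bounded[OF f] by blast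
  have g_pos: "g x > 0" for x by (simp add: g_def mu_pos)
  have g: "mu_bounded g"
  proof (rule mu_boundedI[where C = "exp C"])
    show "\<bar>g x\<bar> \<le> exp C * mu x" for x
      using C(2)[of x] mu_pos[of x] by (simp add: g_def abs_mult)
  qed (simp add: g_def)
  have M_def': "M = (\<integral>x. g x \<partial>lborel)" by (simp add: M_def g_def)
  \<comment> \<open>Strict positivity is needed to divide by \<open>M\<close> and to expand the
    logarithm; boundedness of \<open>f\<close> supplies it.\<close>
  have M_pos: "M > 0"
  proof -
    have "0 < exp (- C) * (\<integral>x. mu x \<partial>lborel)"
      using has_bochner_integral_mu by (simp add: has_bochner_integral_iff)
    also have "\<dots> = (\<integral>x. exp (- C) * mu x \<partial>lborel)" by simp
    also have "\<dots> \<le> M"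
      unfolding M_def'
    proof (rule integral_mono)
      show "exp (- C) * mu x \<le> g x" for x
        using C(2)[of x] mu_pos[of x] by (simp add: g_def)
    qed (use mu_bounded_integrable[OF g] mu_bounded_integrable[OF mu_bounded_mu] in simp_all)
    finally show ?thesis .
  qed
  \<comment> \<open>Chosen so that \<open>(2 / M) * (4 * pi * a) = 1\<close>, the coefficient of the
    integral of \<open>g * f\<close> in the entropy. Then
    \<open>(2 / M) * (2 * pi * a\<^sup>2) = M / (16 * pi)\<close>, which is the constant in front of
    the gradient.\<close>
  define a where "a = M / (8 * pi)"
  define u where "u x = g x + (- M * mu x + a * laplacian f x)" for x
  note l = mu_bounded_laplacian[OF f]
  have u: "mu_bounded u"
    unfolding u_def by (intro mu_bounded_add mu_bounded_cmult g l mu_bounded_mu)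
  have "(\<integral>x. u x \<partial>lborel) = 0"
    unfolding u_def using mu_bounded_integrable[OF g] mu_bounded_integrable[OF l]
      has_bochner_integral_mu integral_laplacian_zero[OF f]
    by (simp add: has_bochner_integral_iff M_def')
  hence "log_energy u u \<le> 0"
    unfolding log_energy_def by (rule log_energy_nonpos[OF u])
  hence E: "log_energy g g + 2 * (- M) * (\<integral>x. g x * mu_pot x \<partial>lborel) + (- M)\<^sup>2 / 2
      + 4 * pi * a * ((\<integral>x. g x * f x \<partial>lborel) + (- M) * (\<integral>x. mu x * f x \<partial>lborel))
      - 2 * pi * a\<^sup>2 * (\<integral>x. grad_norm_sq f x \<partial>lborel) \<le> 0"
    unfolding u_def log_energy_combination[OF g f] .
  have gf: "integrable lborel (\<lambda>x. g x * f x)"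
  proof (rule Bochner_Integration.integrable_bound)
    show "integrable lborel (\<lambda>x. C * g x)" using mu_bounded_integrable[OF g] by simp
    show "AE x in lborel. norm (g x * f x) \<le> norm (C * g x)"
      using C less_imp_le[OF g_pos] by (intro AE_I2) (simp add: abs_mult mult.commute[of C] mult_left_mono)
  qed (simp add: g_def)
  \<comment> \<open>Here \<open>ln (g x / M)\<close> is \<open>f x + ln (mu x) - ln M\<close>, and
    \<open>ln_mu\<close> expresses the middle term through the potential of
    \<open>mu\<close>.\<close>
  have "(\<integral>x. g x * ln (g x / M) \<partial>lborel)
      = (\<integral>x. g x * f x - 4 * (g x * mu_pot x) - (ln pi + ln M) * g x \<partial>lborel)"
  proof (rule Bochner_Integration.integral_cong[OF refl])
    fix x
    have "ln (g x / M) = f x + ln (mu x) - ln M"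
      using mu_pos[of x] M_pos by (simp add: g_def ln_div ln_mult)
    also have "\<dots> = f x - 4 * mu_pot x - (ln pi + ln M)" by (simp add: ln_mu)
    finally show "g x * ln (g x / M) = g x * f x - 4 * (g x * mu_pot x) - (ln pi + ln M) * g x"
      by (simp only:) (simp add: algebra_simps)
  qed
  also have "\<dots> = (\<integral>x. g x * f x \<partial>lborel) - 4 * (\<integral>x. g x * mu_pot x \<partial>lborel) - (ln pi + ln M) * M"
    using gf mu_bounded_integrable_mu_pot[OF g] mu_bounded_integrable[OF g] by (simp add: M_def')
  finally have entropy: "(\<integral>x. g x * ln (g x / M) \<partial>lborel)
      = (\<integral>x. g x * f x \<partial>lborel) - 4 * (\<integral>x. g x * mu_pot x \<partial>lborel) - (ln pi + ln M) * M" .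
  have pairing: "inv_lap_pairing g = - (1 / (2 * pi)) * log_energy g g"
    by (simp add: inv_lap_pairing_def log_energy_def)
  define G W F D Q where "G = log_energy g g" and "W = (\<integral>x. g x * mu_pot x \<partial>lborel)"
    and "F = (\<integral>x. g x * f x \<partial>lborel)" and "D = (\<integral>x. grad_norm_sq f x \<partial>lborel)"
    and "Q = (\<integral>x. f x * mu x \<partial>lborel)"
  have "G - 2 * M * W + M\<^sup>2 / 2 + 4 * pi * a * (F - M * Q) - 2 * pi * a\<^sup>2 * D \<le> 0"
    using E by (simp add: G_def W_def F_def D_def Q_def mult.commute[of "mu _"])
  \<comment> \<open>The factor \<open>2 / M\<close> is the coefficient of \<open>G\<close> on the
    left side of the theorem, since \<open>4 * pi / M\<close> meets \<open>1 / (2 * pi)\<close> from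
    the Green function.\<close>
  hence "(2 / M) * (G - 2 * M * W + M\<^sup>2 / 2 + 4 * pi * a * (F - M * Q) - 2 * pi * a\<^sup>2 * D) \<le> 0"
    using M_pos by (intro mult_nonneg_nonpos) auto
  also have "(2 / M) * (G - 2 * M * W + M\<^sup>2 / 2 + 4 * pi * a * (F - M * Q) - 2 * pi * a\<^sup>2 * D)
      = 2 / M * G - 4 * W + M + (F - M * Q) - M / (16 * pi) * D"
    using M_pos by (simp add: a_def field_simps power2_eq_square)
  finally have "F - 4 * W - (ln pi + ln M) * M + 2 / M * G + M * (1 + ln pi) \<le> M * (1 / (16 * pi) * D + Q - ln M)"
    by (simp add: algebra_simps)
  moreover have "(4 * pi / M) * (- (1 / (2 * pi)) * G) = - (2 / M * G)" by simp
  ultimately show ?thesis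
    unfolding entropy pairing by (simp add: G_def W_def F_def D_def Q_def)
qed

end
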